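(* If $K$ is a knot in $S^3$ which has a non-trivial simple $B_3$-coloring, then there is an epimorphism from the knot group $\pi_1(S^3\setminus K)$ to $B_3$.
   Context: $B_3$ is the three strand braid group with Artin generators $\sigma_1,\sigma_2$. A simple $B_3$-coloring of a knot $K$ is a homomorphism $\pi_1(S^3\setminus K)\to B_3$ sending meridians to conjugates of $\sigma_1^{\pm1}$. It is non-trivial if it is non-constant, i.e. not all meridians (consistently oriented Wirtinger generators of a diagram) have the same image. *)

theory Defs
  imports "HOL-Analysis.Analysis" "HOL-Algebra.Group"
begin

section \<open>Fundamental groups\<close>

definition based_loops :: "'a::real_normed_vector set \<Rightarrow> 'a \<Rightarrow> (real \<Rightarrow> 'a) set" where
  "based_loops S x =
     {p. path p \<and> path_image p \<subseteq> S \<and> pathstart p = x \<and> pathfinish p = x}"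

definition path_class :: "'a::real_normed_vector set \<Rightarrow> (real \<Rightarrow> 'a) \<Rightarrow> (real \<Rightarrow> 'a) set" where
  "path_class S p = {q. homotopic_paths S p q}"

definition fundamental_group ::
    "'a::real_normed_vector set \<Rightarrow> 'a \<Rightarrow> (real \<Rightarrow> 'a) set monoid" where
  "fundamental_group S x =
     \<lparr>carrier = path_class S ` based_loops S x,
      monoid.mult = (\<lambda>A B. {r. \<exists>p\<in>A. \<exists>q\<in>B. homotopic_paths S (p +++ q) r}),
      one = path_class S (linepath x x)\<rparr>"

lemma path_class_eq_iff:
  assumes "p \<in> based_loops S x"
  shows "path_class S p = path_class S q \<longleftrightarrow> homotopic_paths S p q"
proof
  assume "path_class S p = path_class S q"
  moreover have "p \<in> path_class S p"
    using assms by (simp add: path_class_def based_loops_def)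
  ultimately have "homotopic_paths S q p" by (simp add: path_class_def)
  then show "homotopic_paths S p q" by (rule homotopic_paths_sym)
next
  assume pq: "homotopic_paths S p q"
  have "homotopic_paths S p r \<longleftrightarrow> homotopic_paths S q r" for r
    using homotopic_paths_trans[OF pq, of r]
      homotopic_paths_trans[OF homotopic_paths_sym[OF pq], of r] by iprover
  then show "path_class S p = path_class S q" by (simp add: path_class_def)
qed

lemma based_loops_join:
  "\<lbrakk>p \<in> based_loops S x; q \<in> based_loops S x\<rbrakk> \<Longrightarrow> p +++ q \<in> based_loops S x"
  by (auto simp: based_loops_def path_image_join)

lemma fundamental_group_mult:
  assumes p: "p \<in> based_loops S x" and q: "q \<in> based_loops S x"
  shows "path_class S p \<otimes>\<^bsub>fundamental_group S x\<^esub> path_class S q = path_class S (p +++ q)"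
proof -
  have pq: "homotopic_paths S p p" "homotopic_paths S q q"
    using p q by (simp_all add: based_loops_def)
  have "homotopic_paths S (p +++ q) r"
    if "homotopic_paths S p p'" "homotopic_paths S q q'" "homotopic_paths S (p' +++ q') r" for p' q' r
  proof -
    have "homotopic_paths S (p +++ q) (p' +++ q')"
      using that p q by (intro homotopic_paths_join) (auto simp: based_loops_def)
    then show ?thesis using that homotopic_paths_trans by blast
  qed
  then have "(\<exists>p'\<in>path_class S p. \<exists>q'\<in>path_class S q. homotopic_paths S (p' +++ q') r) \<longleftrightarrow>
      homotopic_paths S (p +++ q) r" for r
    using pq unfolding path_class_def mem_Collect_eq Bex_def by iprover
  then show ?thesis
    by (simp add: fundamental_group_def path_class_def)
qed

lemma group_fundamental_group:
  assumes "x \<in> S"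
  shows "group (fundamental_group S x)"
proof -
  let ?G = "fundamental_group S x"
  have car: "carrier ?G = path_class S ` based_loops S x"
    by (simp add: fundamental_group_def)
  have one: "\<one>\<^bsub>?G\<^esub> = path_class S (linepath x x)"
    by (simp add: fundamental_group_def)
  have c: "linepath x x \<in> based_loops S x"
    using assms by (auto simp: based_loops_def)
  show ?thesis
  proof (rule groupI)
    fix A B assume "A \<in> carrier ?G" "B \<in> carrier ?G"
    then show "A \<otimes>\<^bsub>?G\<^esub> B \<in> carrier ?G"
      unfolding car by (auto simp: fundamental_group_mult based_loops_join)
  next
    show "\<one>\<^bsub>?G\<^esub> \<in> carrier ?G" using c by (simp add: car one)
  next
    fix A B C assume "A \<in> carrier ?G" "B \<in> carrier ?G" "C \<in> carrier ?G"
    then obtain p q r where "A = path_class S p" "B = path_class S q" "C = path_class S r"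
      and pqr: "p \<in> based_loops S x" "q \<in> based_loops S x" "r \<in> based_loops S x"
      unfolding car by auto
    moreover have "homotopic_paths S ((p +++ q) +++ r) (p +++ (q +++ r))"
      using pqr by (intro homotopic_paths_sym[OF homotopic_paths_assoc]) (auto simp: based_loops_def)
    ultimately show "A \<otimes>\<^bsub>?G\<^esub> B \<otimes>\<^bsub>?G\<^esub> C = A \<otimes>\<^bsub>?G\<^esub> (B \<otimes>\<^bsub>?G\<^esub> C)"
      by (simp add: fundamental_group_mult based_loops_join path_class_eq_iff[where x = x])
  next
    fix A assume "A \<in> carrier ?G"
    then obtain p where A: "A = path_class S p" and p: "p \<in> based_loops S x"
      unfolding car by auto
    have "homotopic_paths S (linepath x x +++ p) p"
      using p by (intro homotopic_paths_lid') (auto simp: based_loops_def)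
    then show "\<one>\<^bsub>?G\<^esub> \<otimes>\<^bsub>?G\<^esub> A = A"
      using A p c
      by (simp add: one fundamental_group_mult based_loops_join path_class_eq_iff[where x = x])
    have r: "reversepath p \<in> based_loops S x"
      using p by (auto simp: based_loops_def)
    have "homotopic_paths S (reversepath p +++ p) (linepath x x)"
      using p homotopic_paths_linv[of p S] by (auto simp: based_loops_def)
    then have "path_class S (reversepath p) \<otimes>\<^bsub>?G\<^esub> A = \<one>\<^bsub>?G\<^esub>"
      using A p r
      by (simp add: one fundamental_group_mult based_loops_join path_class_eq_iff[where x = x])
    then show "\<exists>B\<in>carrier ?G. B \<otimes>\<^bsub>?G\<^esub> A = \<one>\<^bsub>?G\<^esub>"
      using r unfolding car by blast
  qed
qed


section \<open>The braid group on three strands\<close>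

datatype artin_gen = Gen1 | Gen2

text \<open>A letter is a generator together with a sign: \<open>(s, True)\<close> stands for \<open>s\<close>
  and \<open>(s, False)\<close> for its inverse.\<close>

type_synonym braid_word = "(artin_gen \<times> bool) list"

text \<open>Two words are related iff they represent the same element of the group with Artin's
  presentation \<open>\<langle>Gen1, Gen2 | Gen1 Gen2 Gen1 = Gen2 Gen1 Gen2\<rangle>\<close>.\<close>

inductive braid_eq :: "braid_word \<Rightarrow> braid_word \<Rightarrow> bool" where
  refl: "braid_eq w w"
| sym: "braid_eq v w \<Longrightarrow> braid_eq w v"
| trans: "braid_eq u v \<Longrightarrow> braid_eq v w \<Longrightarrow> braid_eq u w"
| cancel: "braid_eq (u @ [(s, b), (s, \<not> b)] @ v) (u @ v)"
| braid: "braid_eq (u @ [(Gen1, True), (Gen2, True), (Gen1, True)] @ v)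
                   (u @ [(Gen2, True), (Gen1, True), (Gen2, True)] @ v)"

definition braid_class :: "braid_word \<Rightarrow> braid_word set" where
  "braid_class w = {v. braid_eq w v}"

definition B3 :: "braid_word set monoid" where
  "B3 = \<lparr>carrier = range braid_class,
         monoid.mult = (\<lambda>A B. {w. \<exists>u\<in>A. \<exists>v\<in>B. braid_eq (u @ v) w}),
         one = braid_class []\<rparr>"

definition \<sigma>\<^sub>1 :: "braid_word set" where "\<sigma>\<^sub>1 = braid_class [(Gen1, True)]"

definition \<sigma>\<^sub>2 :: "braid_word set" where "\<sigma>\<^sub>2 = braid_class [(Gen2, True)]"

lemma braid_class_eq_iff: "braid_class v = braid_class w \<longleftrightarrow> braid_eq v w"
  unfolding braid_class_def set_eq_iff mem_Collect_eq
  by (meson braid_eq.refl braid_eq.sym braid_eq.trans)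

lemma braid_eq_append_left: "braid_eq u v \<Longrightarrow> braid_eq (w @ u) (w @ v)"
proof (induction rule: braid_eq.induct)
  case (cancel u s b v)
  show ?case using braid_eq.cancel[of "w @ u"] by simp
next
  case (braid u v)
  show ?case using braid_eq.braid[of "w @ u"] by simp
qed (blast intro: braid_eq.refl braid_eq.sym braid_eq.trans)+

lemma braid_eq_append_right: "braid_eq u v \<Longrightarrow> braid_eq (u @ w) (v @ w)"
proof (induction rule: braid_eq.induct)
  case (cancel u s b v)
  show ?case using braid_eq.cancel[of u s b "v @ w"] by simp
next
  case (braid u v)
  show ?case using braid_eq.braid[of u "v @ w"] by simp
qed (blast intro: braid_eq.refl braid_eq.sym braid_eq.trans)+

lemma B3_mult: "braid_class u \<otimes>\<^bsub>B3\<^esub> braid_class v = braid_class (u @ v)"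
proof -
  have "braid_eq (u @ v) w" if "braid_eq u u'" "braid_eq v v'" "braid_eq (u' @ v') w" for u' v' w
    by (meson that braid_eq.trans braid_eq_append_left braid_eq_append_right)
  then show ?thesis
    unfolding B3_def braid_class_def by (auto intro: braid_eq.refl)
qed

lemma group_B3: "group B3"
proof (rule groupI)
  have car: "carrier B3 = range braid_class" and one: "\<one>\<^bsub>B3\<^esub> = braid_class []"
    by (simp_all add: B3_def)
  show "A \<otimes>\<^bsub>B3\<^esub> B \<in> carrier B3" if "A \<in> carrier B3" "B \<in> carrier B3" for A B
    using that by (auto simp: car B3_mult)
  show "\<one>\<^bsub>B3\<^esub> \<in> carrier B3" by (simp add: car one)
  show "A \<otimes>\<^bsub>B3\<^esub> B \<otimes>\<^bsub>B3\<^esub> C = A \<otimes>\<^bsub>B3\<^esub> (B \<otimes>\<^bsub>B3\<^esub> C)"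
    if "A \<in> carrier B3" "B \<in> carrier B3" "C \<in> carrier B3" for A B C
    using that by (auto simp: car B3_mult)
  show "\<one>\<^bsub>B3\<^esub> \<otimes>\<^bsub>B3\<^esub> A = A" if "A \<in> carrier B3" for A
    using that by (auto simp: car one B3_mult)
  have "\<exists>v. braid_eq (v @ w) []" for w
  proof (induction w)
    case Nil
    show ?case using braid_eq.refl[of "[]"] by (metis append_Nil)
  next
    case (Cons a w)
    then obtain v where v: "braid_eq (v @ w) []" by blast
    obtain s b where a: "a = (s, b)" by (cases a)
    have "braid_eq (v @ [(s, \<not> b), (s, \<not> \<not> b)] @ w) (v @ w)"
      by (rule braid_eq.cancel)
    then have "braid_eq ((v @ [(s, \<not> b)]) @ a # w) []"
      using v a by (auto intro: braid_eq.trans)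
    then show ?case by blast
  qed
  then show "\<exists>B\<in>carrier B3. B \<otimes>\<^bsub>B3\<^esub> A = \<one>\<^bsub>B3\<^esub>" if "A \<in> carrier B3" for A
    using that by (fastforce simp: car one B3_mult braid_class_eq_iff)
qed


section \<open>Knots, knot groups and meridians\<close>

abbreviation S3 :: "(real^4) set" where "S3 \<equiv> sphere 0 1"

text \<open>\<open>N\<close> embeds the solid torus \<open>S\<^sup>1 \<times> D\<^sup>2\<close> in the 3-sphere with core \<open>K\<close>
  (an injective continuous map on a compact set is a homeomorphism onto its image).\<close>

definition tubular_neighbourhood ::
    "(real^4) set \<Rightarrow> (complex \<times> complex \<Rightarrow> real^4) \<Rightarrow> bool" where
  "tubular_neighbourhood K N \<longleftrightarrow>
     continuous_on (sphere 0 1 \<times> cball 0 1) N \<and>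
     inj_on N (sphere 0 1 \<times> cball 0 1) \<and>
     N ` (sphere 0 1 \<times> cball 0 1) \<subseteq> S3 \<and>
     N ` (sphere 0 1 \<times> {0}) = K"

text \<open>As usual in classical knot theory, knots are tame (every smooth or polygonal knot has such
  a neighbourhood).\<close>

definition knot :: "(real^4) set \<Rightarrow> bool" where
  "knot K \<longleftrightarrow> (\<exists>N. tubular_neighbourhood K N)"

definition knot_group :: "(real^4) set \<Rightarrow> real^4 \<Rightarrow> (real \<Rightarrow> real^4) set monoid" where
  "knot_group K x\<^sub>0 = fundamental_group (S3 - K) x\<^sub>0"

text \<open>A meridian runs from the base point along a path in the knot complement to the boundary
  of a fibre disc of the tubular neighbourhood, once around that boundary, and back along the
  same path.  Since the boundary circles \<open>t \<mapsto> N (z, cis (2 * pi * t))\<close> depend continuously on \<open>z\<close>,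
  the meridians belonging to one and the same \<open>N\<close> are consistently oriented; composing \<open>N\<close> with
  complex conjugation of the second coordinate reverses all of them.\<close>

definition meridian_circle ::
    "(complex \<times> complex \<Rightarrow> real^4) \<Rightarrow> complex \<Rightarrow> real \<Rightarrow> real^4" where
  "meridian_circle N z = (\<lambda>t. N (z, cis (2 * pi * t)))"

definition meridians ::
    "(real^4) set \<Rightarrow> (complex \<times> complex \<Rightarrow> real^4) \<Rightarrow> real^4 \<Rightarrow> (real \<Rightarrow> real^4) set set" where
  "meridians K N x\<^sub>0 =
     {path_class (S3 - K) (\<gamma> +++ meridian_circle N z +++ reversepath \<gamma>) | \<gamma> z.
        z \<in> sphere 0 1 \<and> path \<gamma> \<and> path_image \<gamma> \<subseteq> S3 - K \<and>
        pathstart \<gamma> = x\<^sub>0 \<and> pathfinish \<gamma> = N (z, 1)}"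

lemma meridians_subset_knot_group:
  assumes "tubular_neighbourhood K N"
  shows "meridians K N x\<^sub>0 \<subseteq> carrier (knot_group K x\<^sub>0)"
proof
  fix m assume "m \<in> meridians K N x\<^sub>0"
  then obtain \<gamma> z where m: "m = path_class (S3 - K) (\<gamma> +++ meridian_circle N z +++ reversepath \<gamma>)"
    and z: "z \<in> sphere 0 1" and \<gamma>: "path \<gamma>" "path_image \<gamma> \<subseteq> S3 - K"
      "pathstart \<gamma> = x\<^sub>0" "pathfinish \<gamma> = N (z, 1)"
    unfolding meridians_def by blast
  let ?c = "meridian_circle N z"
  have cont: "continuous_on (sphere 0 1 \<times> cball 0 1) N"
    and inj: "inj_on N (sphere 0 1 \<times> cball 0 1)"
    and sub: "N ` (sphere 0 1 \<times> cball 0 1) \<subseteq> S3"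
    and core: "N ` (sphere 0 1 \<times> {0}) = K"
    using assms by (simp_all add: tubular_neighbourhood_def)
  have mem: "(z, cis a) \<in> sphere 0 1 \<times> cball 0 1" for a
    using z by simp
  have ends: "pathstart ?c = N (z, 1)" "pathfinish ?c = N (z, 1)"
    by (simp_all add: meridian_circle_def pathstart_def pathfinish_def)
  have "continuous_on {0..1} (\<lambda>t::real. (z, cis (2 * pi * t)))"
    by (intro continuous_intros)
  then have "path ?c"
    unfolding path_def meridian_circle_def
    by (rule continuous_on_compose2[OF cont]) (use mem in blast)
  moreover have "path_image ?c \<subseteq> S3 - K"
  proof
    fix y assume "y \<in> path_image ?c"
    then obtain t where y: "y = N (z, cis (2 * pi * t))"
      unfolding path_image_def meridian_circle_def by blast
    have "y \<in> S3" using sub mem unfolding y by blast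
    moreover have "y \<notin> K"
    proof
      assume "y \<in> K"
      then obtain w where w: "w \<in> sphere 0 1" "y = N (w, 0)"
        unfolding core[symmetric] by blast
      have "(w, 0) = (z, cis (2 * pi * t))"
        by (rule inj_onD[OF inj]) (use w y mem in simp_all)
      then show False by simp
    qed
    ultimately show "y \<in> S3 - K" by simp
  qed
  ultimately have "\<gamma> +++ ?c +++ reversepath \<gamma> \<in> based_loops (S3 - K) x\<^sub>0"
    using \<gamma> ends by (simp add: based_loops_def path_image_join)
  then show "m \<in> carrier (knot_group K x\<^sub>0)"
    unfolding m knot_group_def fundamental_group_def by simp
qed


section \<open>Simple colorings\<close>

definition conjugates :: "('a, 'b) monoid_scheme \<Rightarrow> 'a \<Rightarrow> 'a set" where
  "conjugates G a = {g \<otimes>\<^bsub>G\<^esub> a \<otimes>\<^bsub>G\<^esub> inv\<^bsub>G\<^esub> g | g. g \<in> carrier G}"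

definition simple_B3_coloring ::
    "(real^4) set \<Rightarrow> (complex \<times> complex \<Rightarrow> real^4) \<Rightarrow> real^4 \<Rightarrow>
     ((real \<Rightarrow> real^4) set \<Rightarrow> braid_word set) \<Rightarrow> bool" where
  "simple_B3_coloring K N x\<^sub>0 \<phi> \<longleftrightarrow>
     \<phi> \<in> hom (knot_group K x\<^sub>0) B3 \<and>
     (\<forall>m \<in> meridians K N x\<^sub>0. \<phi> m \<in> conjugates B3 \<sigma>\<^sub>1 \<union> conjugates B3 (inv\<^bsub>B3\<^esub> \<sigma>\<^sub>1))"

definition nontrivial_coloring ::
    "(real^4) set \<Rightarrow> (complex \<times> complex \<Rightarrow> real^4) \<Rightarrow> real^4 \<Rightarrow>
     ((real \<Rightarrow> real^4) set \<Rightarrow> braid_word set) \<Rightarrow> bool" where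
  "nontrivial_coloring K N x\<^sub>0 \<phi> \<longleftrightarrow>
     (\<exists>m \<in> meridians K N x\<^sub>0. \<exists>m' \<in> meridians K N x\<^sub>0. \<phi> m \<noteq> \<phi> m')"

end

theory Submission
  imports Defs "HOL-Algebra.Bij" "HOL-Algebra.Generated_Groups"
begin

text \<open>
  A non-trivial simple coloring is, up to an inner automorphism of \<open>B3\<close>, already an epimorphism.
  Two facts about the knot group carry the proof: all meridians are conjugate
  (\<open>meridians_conjugate\<close>), and they generate it normally, in the form that a homomorphism which is
  one on all meridians is one everywhere (\<open>hom_trivial_if_kills_meridians\<close>).

  The second fact is van Kampen's theorem for the cover of the 3-sphere by the knot complement and
  the open tube. A homomorphism \<open>f\<close> out of the knot group is spread over the fundamental groupoid of
  the complement. Paths in the tube are evaluated by projecting them to the parallel curve on the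
  boundary of the tube. As \<open>f\<close> kills meridians, the two evaluations agree, after a change of
  reference, on the punctured tube (\<open>push_out\<close>); so together they give a functor that is
  locally defined on the whole sphere. Every loop contracts in the 3-sphere, hence gets the value one.

  For the algebra, let \<open>H\<close> be the image of a coloring, conjugated so that \<open>\<sigma>\<^sub>1\<close> belongs to \<open>H\<close>. Every
  homomorphism on \<open>H\<close> that kills \<open>\<sigma>\<^sub>1\<close> is trivial. With \<open>\<Delta> = \<sigma>\<^sub>1\<sigma>\<^sub>2\<sigma>\<^sub>1\<close> and \<open>\<delta> = \<sigma>\<^sub>1\<sigma>\<^sub>2\<close>, the group \<open>B3\<close> is
  presented by \<open>\<Delta>\<^sup>2 = \<delta>\<^sup>3\<close>, and this element \<open>\<zeta>\<close> is central. Let \<open>M\<close> be generated by \<open>H\<close> and \<open>\<zeta>\<close>.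
  If \<open>\<delta>\<close> belongs to \<open>M\<close>, then some \<open>\<delta>\<zeta>\<^sup>k\<close> belongs to \<open>H\<close>, whence \<open>\<sigma>\<^sub>2 = \<delta>\<sigma>\<^sub>1\<delta>\<^sup>-\<^sup>1\<close> is in \<open>H\<close> and \<open>H = B3\<close>.
  Otherwise \<open>M\<close> splits modulo \<open>\<zeta>\<close> as a free product of the infinite cyclic group on \<open>\<sigma>\<^sub>1\<close> with another
  factor: \<open>\<Delta>\<close> and \<open>\<delta>\<close> carry the coset \<open>M\<close> to the same coset \<open>\<delta>M\<close>, which makes a loop in the quotient by
  \<open>M\<close> of the tree of the free product \<open>B3/\<langle>\<zeta>\<rangle> = Z/2 * Z/3\<close>. Killing \<open>\<sigma>\<^sub>1\<close> is projection to the other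
  factor, so that factor is trivial and \<open>H\<close> centralizes \<open>\<sigma>\<^sub>1\<close>. Then all meridians have the same
  image, and the coloring is trivial (\<open>subgroup_B3_dichotomy\<close>). The projection is realized
  concretely by a modified action of \<open>B3\<close> on itself (\<open>twisted_half_twist\<close>), which replaces the
  theory of subgroups of free products.
\<close>

section \<open>Functors on the fundamental groupoid\<close>

text \<open>A functor from the fundamental groupoid of \<open>U\<close> to the group \<open>G\<close>, given on representing paths.
  Homomorphisms on loops at one base point would not do: a homotopy is cut into small cells, whose
  edges are no loops.\<close>

definition path_functor ::
    "('g, 'm) monoid_scheme \<Rightarrow> 'a::real_normed_vector set \<Rightarrow> ((real \<Rightarrow> 'a) \<Rightarrow> 'g) \<Rightarrow> bool" where
  "path_functor G U F \<longleftrightarrow>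
     (\<forall>p. path p \<longrightarrow> path_image p \<subseteq> U \<longrightarrow> F p \<in> carrier G) \<and>
     (\<forall>p q. path p \<longrightarrow> path_image p \<subseteq> U \<longrightarrow> path q \<longrightarrow> path_image q \<subseteq> U \<longrightarrow>
        pathfinish p = pathstart q \<longrightarrow> F (p +++ q) = F p \<otimes>\<^bsub>G\<^esub> F q) \<and>
     (\<forall>p q. homotopic_paths U p q \<longrightarrow> F p = F q)"

lemma path_functor_closed:
  "\<lbrakk>path_functor G U F; path p; path_image p \<subseteq> U\<rbrakk> \<Longrightarrow> F p \<in> carrier G"
  by (simp add: path_functor_def)

lemma path_functor_join:
  "\<lbrakk>path_functor G U F; path p; path_image p \<subseteq> U; path q; path_image q \<subseteq> U;
    pathfinish p = pathstart q\<rbrakk> \<Longrightarrow> F (p +++ q) = F p \<otimes>\<^bsub>G\<^esub> F q"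
  by (simp add: path_functor_def)

lemma path_functor_homotopic:
  "\<lbrakk>path_functor G U F; homotopic_paths U p q\<rbrakk> \<Longrightarrow> F p = F q"
  by (simp add: path_functor_def)

text \<open>Paths with common ends in a convex set are homotopic along straight lines. The homotopies below that
  depend on the knot are images of such ones, with a square or a half plane of parameters.\<close>

lemma homotopic_paths_convex_image:
  fixes g :: "'a::real_normed_vector \<Rightarrow> 'b::real_normed_vector"
  assumes C: "convex C" and g: "continuous_on C g" "g ` C \<subseteq> S"
    and p: "path p" "path_image p \<subseteq> C" and q: "path q" "path_image q \<subseteq> C"
    and ends: "pathstart q = pathstart p" "pathfinish q = pathfinish p"
  shows "homotopic_paths S (g \<circ> p) (g \<circ> q)"
proof (rule homotopic_paths_continuous_image)
  show "homotopic_paths C p q"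
  proof (rule homotopic_paths_linear)
    show "closed_segment (p t) (q t) \<subseteq> C" if "t \<in> {0..1}" for t
      using that p q C by (intro closed_segment_subset) (auto simp: path_image_def)
  qed (use p q ends in auto)
qed (use g in auto)

lemma segment_image:
  assumes "convex C" "a \<in> C" "b \<in> C" "continuous_on C g" "g ` C \<subseteq> S"
  shows "path (g \<circ> linepath a b)" "path_image (g \<circ> linepath a b) \<subseteq> S"
proof -
  have ab: "closed_segment a b \<subseteq> C" using assms by (simp add: closed_segment_subset)
  show "path (g \<circ> linepath a b)"
    using ab assms(4) by (intro path_continuous_image) (auto intro: continuous_on_subset)
  show "path_image (g \<circ> linepath a b) \<subseteq> S"
    using ab assms(5) by (auto simp: path_image_compose)
qed

lemma path_functor_convex:
  fixes g :: "'c::real_normed_vector \<Rightarrow> 'a::real_normed_vector"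
  assumes F: "path_functor G U F" and C: "convex C" and g: "continuous_on C g" "g ` C \<subseteq> U"
    and abc: "a \<in> C" "b \<in> C" "c \<in> C"
  shows "F (g \<circ> linepath a b) \<otimes>\<^bsub>G\<^esub> F (g \<circ> linepath b c) = F (g \<circ> linepath a c)"
proof -
  have "F (g \<circ> linepath a b) \<otimes>\<^bsub>G\<^esub> F (g \<circ> linepath b c) = F ((g \<circ> linepath a b) +++ (g \<circ> linepath b c))"
    using segment_image[OF C _ _ g] abc
    by (intro path_functor_join[OF F, symmetric]) (auto simp: pathstart_compose pathfinish_compose)
  also have "\<dots> = F (g \<circ> (linepath a b +++ linepath b c))"
    by (simp add: path_compose_join)
  also have "\<dots> = F (g \<circ> linepath a c)"
  proof (rule path_functor_homotopic[OF F], rule homotopic_paths_convex_image[OF C g])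
    show "path_image (linepath a b +++ linepath b c) \<subseteq> C"
      using abc C by (simp add: path_image_join closed_segment_subset)
  qed (use abc C in \<open>auto simp: closed_segment_subset\<close>)
  finally show ?thesis .
qed

lemma (in group) path_functor_linepath_refl:
  assumes F: "path_functor G U F" and x: "x \<in> U"
  shows "F (linepath x x) = \<one>"
proof -
  have "F (linepath x x) \<otimes> F (linepath x x) = F (linepath x x)"
    using path_functor_convex[OF F, of "{x}" id x x x] x by simp
  moreover have "F (linepath x x) \<in> carrier G"
    using x by (intro path_functor_closed[OF F]) auto
  ultimately show ?thesis using l_cancel_one by blast
qed

lemma (in group) path_functor_reversepath:
  assumes F: "path_functor G U F" and p: "path p" "path_image p \<subseteq> U"
  shows "F (reversepath p) = inv (F p)"
proof (rule inv_equality[symmetric])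
  have "F (reversepath p) \<otimes> F p = F (reversepath p +++ p)"
    using p by (intro path_functor_join[OF F, symmetric]) auto
  also have "\<dots> = F (linepath (pathfinish p) (pathfinish p))"
    by (intro path_functor_homotopic[OF F] homotopic_paths_linv p)
  also have "\<dots> = \<one>"
    using p by (intro path_functor_linepath_refl[OF F]) (auto simp: pathfinish_in_path_image subsetD)
  finally show "F (reversepath p) \<otimes> F p = \<one>" .
  show "F p \<in> carrier G" "F (reversepath p) \<in> carrier G"
    using p by (auto intro!: path_functor_closed[OF F])
qed

lemma path_class_homotopic: "homotopic_paths S p q \<Longrightarrow> path_class S p = path_class S q"
  unfolding path_class_def using homotopic_paths_trans homotopic_paths_sym by blast

text \<open>A path \<open>p\<close> is turned into a loop by adding chosen paths from the base point to its two ends; the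
  chosen paths cancel in products. On components that the base point cannot reach the functor is
  constant.\<close>

lemma extend_hom_to_groupoid:
  assumes "group G" and f: "f \<in> hom (fundamental_group U x\<^sub>0) G" and x\<^sub>0: "x\<^sub>0 \<in> U"
  obtains F where "path_functor G U F"
    "\<And>p. p \<in> based_loops U x\<^sub>0 \<Longrightarrow> F p = f (path_class U p)"
    "\<And>p. \<lbrakk>path p; path_image p \<subseteq> U; \<not> path_component U x\<^sub>0 (pathstart p)\<rbrakk> \<Longrightarrow> F p = \<one>\<^bsub>G\<^esub>"
proof -
  interpret G: group G by fact
  let ?P = "fundamental_group U x\<^sub>0"
  have grP: "group ?P" by (rule group_fundamental_group[OF x\<^sub>0])
  have car: "carrier ?P = path_class U ` based_loops U x\<^sub>0" by (simp add: fundamental_group_def)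
  have fcl: "f (path_class U p) \<in> carrier G" if "p \<in> based_loops U x\<^sub>0" for p
    using f that by (auto simp: hom_def car)
  have fmult: "f (path_class U (p +++ q)) = f (path_class U p) \<otimes>\<^bsub>G\<^esub> f (path_class U q)"
    if "p \<in> based_loops U x\<^sub>0" "q \<in> based_loops U x\<^sub>0" for p q
    using hom_mult[OF f, of "path_class U p" "path_class U q"] that
    by (simp add: car fundamental_group_mult)
  define R where "R x \<longleftrightarrow> path_component U x\<^sub>0 x" for x
  \<comment> \<open>The constant path is chosen at the base point, so that loops there keep the value under f.\<close>
  define c where "c x = (if x = x\<^sub>0 then linepath x\<^sub>0 x\<^sub>0 else
     SOME c. path c \<and> path_image c \<subseteq> U \<and> pathstart c = x\<^sub>0 \<and> pathfinish c = x)" for x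
  have c: "path (c x)" "path_image (c x) \<subseteq> U" "pathstart (c x) = x\<^sub>0" "pathfinish (c x) = x" if "R x" for x
  proof -
    have "path (c x) \<and> path_image (c x) \<subseteq> U \<and> pathstart (c x) = x\<^sub>0 \<and> pathfinish (c x) = x"
    proof (cases "x = x\<^sub>0")
      case True
      then show ?thesis using x\<^sub>0 by (simp add: c_def)
    next
      case False
      have "\<exists>c. path c \<and> path_image c \<subseteq> U \<and> pathstart c = x\<^sub>0 \<and> pathfinish c = x"
        using that unfolding R_def path_component_def by blast
      from someI_ex[OF this] show ?thesis using False by (simp add: c_def)
    qed
    then show "path (c x)" "path_image (c x) \<subseteq> U" "pathstart (c x) = x\<^sub>0" "pathfinish (c x) = x" by auto
  qed
  have Rp: "R (pathfinish p) \<longleftrightarrow> R (pathstart p)" if "path p" "path_image p \<subseteq> U" for p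
  proof -
    have "path_component U (pathstart p) (pathfinish p)"
      using that unfolding path_component_def by blast
    then show ?thesis
      unfolding R_def by (meson path_component_sym path_component_trans)
  qed
  define L where "L p = (c (pathstart p) +++ p) +++ reversepath (c (pathfinish p))" for p
  have L: "L p \<in> based_loops U x\<^sub>0" if "path p" "path_image p \<subseteq> U" "R (pathstart p)" for p
    using that c Rp[OF that(1,2)] by (simp add: L_def based_loops_def path_image_join)
  define F where "F p = (if R (pathstart p) then f (path_class U (L p)) else \<one>\<^bsub>G\<^esub>)" for p
  have join: "F (p +++ q) = F p \<otimes>\<^bsub>G\<^esub> F q"
    if p: "path p" "path_image p \<subseteq> U" and q: "path q" "path_image q \<subseteq> U"
      and pq: "pathfinish p = pathstart q" for p q
  proof (cases "R (pathstart p)")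
    case True
    then have Rq: "R (pathstart q)" "R (pathfinish q)" using Rp[OF p] Rp[OF q] pq by auto
    let ?a = "c (pathstart p)" and ?b = "c (pathstart q)" and ?d = "reversepath (c (pathfinish q))"
    note cs = c[OF True] c[OF Rq(1)] c[OF Rq(2)]
    let ?h = "homotopic_paths U"
    note [trans] = homotopic_paths_trans
    have "?h (L p +++ L q) (((?a +++ p) +++ reversepath ?b) +++ (?b +++ (q +++ ?d)))"
      unfolding L_def pq using cs p q pq
      by (intro homotopic_paths_join homotopic_paths_sym[OF homotopic_paths_assoc])
        (auto simp: path_image_join)
    also have "?h \<dots> ((((?a +++ p) +++ reversepath ?b) +++ ?b) +++ (q +++ ?d))"
      using cs p q pq by (intro homotopic_paths_assoc) (auto simp: path_image_join)
    also have "?h \<dots> ((?a +++ p) +++ (q +++ ?d))"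
    proof (rule homotopic_paths_join)
      have "?h (((?a +++ p) +++ reversepath ?b) +++ ?b) ((?a +++ p) +++ (reversepath ?b +++ ?b))"
        using cs p q pq by (intro homotopic_paths_sym[OF homotopic_paths_assoc]) (auto simp: path_image_join)
      also have "?h \<dots> ((?a +++ p) +++ linepath (pathfinish ?b) (pathfinish ?b))"
        using cs p q pq by (intro homotopic_paths_join homotopic_paths_linv) (auto simp: path_image_join)
      also have "?h \<dots> (?a +++ p)"
        using cs p q pq by (intro homotopic_paths_rid') (auto simp: path_image_join)
      finally show "?h (((?a +++ p) +++ reversepath ?b) +++ ?b) (?a +++ p)" .
    qed (use cs p q pq in \<open>auto simp: path_image_join\<close>)
    also have "?h \<dots> (((?a +++ p) +++ q) +++ ?d)"
      using cs p q pq by (intro homotopic_paths_assoc) (auto simp: path_image_join)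
    also have "?h \<dots> (L (p +++ q))"
    proof -
      have "?h ((?a +++ p) +++ q) (?a +++ (p +++ q))"
        using cs p q pq by (intro homotopic_paths_sym[OF homotopic_paths_assoc]) auto
      then have "?h (((?a +++ p) +++ q) +++ ?d) ((?a +++ (p +++ q)) +++ ?d)"
        by (rule homotopic_paths_join) (use cs p q pq in \<open>auto simp: path_image_join\<close>)
      then show ?thesis by (simp add: L_def)
    qed
    finally have "path_class U (L (p +++ q)) = path_class U (L p +++ L q)"
      by (rule path_class_homotopic[OF homotopic_paths_sym])
    then show ?thesis
      using True Rq p q by (simp add: F_def fmult L)
  next
    case False
    then show ?thesis using Rp[OF p] pq by (simp add: F_def)
  qed
  have "path_functor G U F"
    unfolding path_functor_def
  proof (intro conjI allI impI)
    show "F p \<in> carrier G" if "path p" "path_image p \<subseteq> U" for p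
      using that by (simp add: F_def fcl L)
    show "F (p +++ q) = F p \<otimes>\<^bsub>G\<^esub> F q"
      if "path p" "path_image p \<subseteq> U" "path q" "path_image q \<subseteq> U" "pathfinish p = pathstart q" for p q
      using join that by blast
    show "F p = F q" if pq: "homotopic_paths U p q" for p q
    proof (cases "R (pathstart p)")
      case True
      have p: "path p" "path_image p \<subseteq> U" "path q" "path_image q \<subseteq> U"
        and e: "pathstart q = pathstart p" "pathfinish q = pathfinish p"
        using pq homotopic_paths_imp_path homotopic_paths_imp_subset
          homotopic_paths_imp_pathstart homotopic_paths_imp_pathfinish by metis+
      have Rq: "R (pathfinish p)" using Rp p True by blast
      have "homotopic_paths U (L p) (L q)"
        unfolding L_def e using c[OF True] c[OF Rq] p e pq
        by (intro homotopic_paths_join) auto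
      then show ?thesis using True e by (simp add: F_def path_class_homotopic)
    next
      case False
      then show ?thesis using homotopic_paths_imp_pathstart[OF pq] by (simp add: F_def)
    qed
  qed
  moreover have "F p = f (path_class U p)" if p: "p \<in> based_loops U x\<^sub>0" for p
  proof -
    have pp: "path p" "path_image p \<subseteq> U" "pathstart p = x\<^sub>0" "pathfinish p = x\<^sub>0"
      using p by (auto simp: based_loops_def)
    have "R x\<^sub>0" using x\<^sub>0 by (simp add: R_def path_component_refl)
    have "homotopic_paths U (L p) (linepath x\<^sub>0 x\<^sub>0 +++ p)"
      using pp x\<^sub>0 by (auto simp: L_def c_def path_image_join intro!: homotopic_paths_rid')
    then have "homotopic_paths U (L p) p"
      using homotopic_paths_lid'[of p U x\<^sub>0] pp homotopic_paths_trans by auto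
    then show ?thesis using \<open>R x\<^sub>0\<close> pp by (simp add: F_def path_class_homotopic)
  qed
  moreover have "F p = \<one>\<^bsub>G\<^esub>" if "\<not> path_component U x\<^sub>0 (pathstart p)" for p
    using that by (simp add: F_def R_def)
  ultimately show thesis using that by blast
qed

lemma path_functor_cong:
  assumes F: "path_functor G U F" and p: "path p" "path_image p \<subseteq> U"
    and eq: "\<And>t. t \<in> {0..1} \<Longrightarrow> q t = p t"
  shows "F q = F p"
  by (rule path_functor_homotopic[OF F, symmetric], rule homotopic_paths_eq[OF p]) (simp add: eq)

lemma (in group) path_functor_constant:
  assumes F: "path_functor G U F" and x: "x \<in> U" and eq: "\<And>t. t \<in> {0..1} \<Longrightarrow> q t = x"
  shows "F q = \<one>"
proof -
  have "F q = F (linepath x x)"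
  proof (rule path_functor_cong[OF F])
    show "q t = linepath x x t" if "t \<in> {0..1}" for t
      by (simp add: eq[OF that] linepath_def)
  qed (use x in auto)
  then show ?thesis by (simp add: path_functor_linepath_refl[OF F x])
qed

text \<open>The uniqueness half of van Kampen's theorem. Subdivide the square of the homotopy until every
  cell lies over \<open>U\<close> or over \<open>V\<close>. In each cell the two ways along the edges between opposite corners
  have the same value, so the products over consecutive rows of edges agree; the first and the last
  row give \<open>p\<close> and \<open>q\<close>.\<close>

lemma path_functor_two_open_sets:
  fixes S :: "'a::real_normed_vector set"
  assumes "group G" and FU: "path_functor G U F" and FV: "path_functor G V F"
    and U: "openin (top_of_set S) U" and V: "openin (top_of_set S) V" and S: "S \<subseteq> U \<union> V"
    and hom: "homotopic_paths S p q" and pU: "path_image p \<subseteq> U" and qU: "path_image q \<subseteq> U"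
  shows "F p = F q"
proof -
  interpret G: group G by fact
  let ?I = "{0..1::real}" let ?Q = "?I \<times> ?I"
  have pp: "path p" "path q" using hom homotopic_paths_imp_path by blast+
  have pq: "pathstart p \<in> U" "pathfinish p \<in> U"
    using pU pathstart_in_path_image[of p] pathfinish_in_path_image[of p] by blast+
  obtain h where h: "continuous_on ?Q h" "h \<in> ?Q \<rightarrow> S"
    and h01: "\<forall>t\<in>?I. h (0, t) = p t" "\<forall>t\<in>?I. h (1, t) = q t"
    and hlr: "\<forall>s\<in>?I. pathstart (h \<circ> Pair s) = pathstart p \<and> pathfinish (h \<circ> Pair s) = pathfinish p"
    using iffD1[OF homotopic_paths hom] by (elim exE conjE)
  have hl: "h (s, 0) = pathstart p" and hr: "h (s, 1) = pathfinish p" if "s \<in> ?I" for s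
    using hlr that by (auto simp: pathstart_def pathfinish_def)
  obtain OU where OU: "open OU" "?Q \<inter> h -` U = ?Q \<inter> OU"
    using continuous_openin_preimage[OF h U] unfolding openin_open by blast
  obtain OV where OV: "open OV" "?Q \<inter> h -` V = ?Q \<inter> OV"
    using continuous_openin_preimage[OF h V] unfolding openin_open by blast
  have QUV: "?Q \<subseteq> \<Union>{OU, OV}" 
  proof
    fix y assume y: "y \<in> ?Q"
    then have "h y \<in> U \<union> V" using funcset_mem[OF h(2)] S by blast
    then have "y \<in> ?Q \<inter> h -` U \<or> y \<in> ?Q \<inter> h -` V" using y by simp
    then show "y \<in> \<Union>{OU, OV}" unfolding OU(2) OV(2) by blast
  qed
  obtain \<delta> where \<delta>: "0 < \<delta>" "\<And>T. \<lbrakk>T \<subseteq> ?Q; diameter T < \<delta>\<rbrakk> \<Longrightarrow> \<exists>B\<in>{OU, OV}. T \<subseteq> B"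
    by (rule Lebesgue_number_lemma[of ?Q "{OU, OV}"])
      (use QUV OU(1) OV(1) in \<open>auto intro: compact_Times\<close>)
  \<comment> \<open>A square cell of side 1 / n has diameter at most 2 / n.\<close>
  obtain n :: nat where n: "2 / \<delta> < real n" using reals_Archimedean2 by blast
  have n0: "0 < real n" using n divide_pos_pos[of 2 \<delta>] \<delta>(1) by linarith
  have n\<delta>: "2 / real n < \<delta>" using n n0 \<delta>(1) by (simp add: field_simps)
  define pt where "pt j i = (real j / real n, real i / real n)" for j i
  define e where "e a b = F (h \<circ> linepath a b)" for a b
  define cell where "cell j i = {real j / n..real (Suc j) / n} \<times> {real i / n..real (Suc i) / n}" for j i
  have cell: "convex (cell j i)" "pt j i \<in> cell j i" "pt (Suc j) i \<in> cell j i"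
    "pt j (Suc i) \<in> cell j i" "pt (Suc j) (Suc i) \<in> cell j i" for j i
    using n0 by (auto simp: cell_def pt_def convex_Times divide_right_mono)
  have cellQ: "cell j i \<subseteq> ?Q" if "j < n" "i < n" for i j
  proof -
    have "{real k / n..real (Suc k) / n} \<subseteq> ?I" if "k < n" for k
    proof -
      have "0 \<le> real k / n" "real (Suc k) / n \<le> 1" using that n0 by simp_all
      then show ?thesis by (simp only: atLeastatMost_subset_iff simp_thms)
    qed
    then show ?thesis unfolding cell_def using that by (intro Sigma_mono)
  qed
  have small: "\<exists>X. path_functor G X F \<and> h ` cell j i \<subseteq> X" if ji: "j < n" "i < n" for i j
  proof -
    have "diameter (cell j i) \<le> 2 / n"
    proof (rule diameter_le)
      fix x y assume xy: "x \<in> cell j i" "y \<in> cell j i"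
      have "norm (x - y) \<le> norm (fst (x - y)) + norm (snd (x - y))"
        by (metis norm_Pair_le prod.collapse)
      also have "\<dots> \<le> 1 / n + 1 / n"
        using xy by (intro add_mono) (auto simp: cell_def add_divide_distrib abs_le_iff)
      finally show "norm (x - y) \<le> 2 / n" by simp
    qed (use n0 in auto)
    then have "diameter (cell j i) < \<delta>" using n\<delta> by simp
    then have "cell j i \<subseteq> OU \<or> cell j i \<subseteq> OV" using \<delta>(2)[OF cellQ[OF ji]] by auto
    then have "h ` cell j i \<subseteq> U \<or> h ` cell j i \<subseteq> V"
      using cellQ[OF ji] OU(2) OV(2) by blast
    then show ?thesis using FU FV by blast
  qed
  have tri_ecl: "e a b \<otimes>\<^bsub>G\<^esub> e b c = e a c \<and> e a b \<in> carrier G"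
    if "j < n" "i < n" "a \<in> cell j i" "b \<in> cell j i" "c \<in> cell j i" for i j a b c
  proof -
    obtain X where X: "path_functor G X F" "h ` cell j i \<subseteq> X" using small \<open>j < n\<close> \<open>i < n\<close> by blast
    have ch: "continuous_on (cell j i) h"
      using continuous_on_subset[OF h(1) cellQ] that(1,2) by blast
    have "e a b \<otimes>\<^bsub>G\<^esub> e b c = e a c" unfolding e_def
      by (rule path_functor_convex[OF X(1) cell(1) ch X(2) that(3-5)])
    moreover have "e a b \<in> carrier G" unfolding e_def
      by (intro path_functor_closed[OF X(1)] segment_image[OF cell(1) that(3,4) ch X(2)])
    ultimately show ?thesis by blast
  qed
  have tri: "e a b \<otimes>\<^bsub>G\<^esub> e b c = e a c"
    if "j < n" "i < n" "a \<in> cell j i" "b \<in> cell j i" "c \<in> cell j i" for i j a b c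
    using tri_ecl[OF that] by blast
  have ecl: "e a b \<in> carrier G" if "j < n" "i < n" "a \<in> cell j i" "b \<in> cell j i" for i j a b
    using tri_ecl[OF that that(3)] by blast
  define W where "W j = rec_nat \<one>\<^bsub>G\<^esub> (\<lambda>i w. w \<otimes>\<^bsub>G\<^esub> e (pt j i) (pt j (Suc i)))" for j
  have W0: "W j 0 = \<one>\<^bsub>G\<^esub>" and WS: "W j (Suc i) = W j i \<otimes>\<^bsub>G\<^esub> e (pt j i) (pt j (Suc i))" for j i
    by (simp_all add: W_def)
  have lin: "linepath (pt j i) (pt k l) t = (linepath (real j / n) (real k / n) t, linepath (real i / n) (real l / n) t)" for i j k l t
    by (simp add: linepath_def pt_def)
  have inI: "linepath (real j / n) (real k / n) t \<in> ?I" if "j \<le> n" "k \<le> n" "t \<in> ?I" for j k t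
  proof -
    have "closed_segment (real j / n) (real k / n) \<subseteq> ?I"
      using that n0 by (intro closed_segment_subset) auto
    then show ?thesis using that(3) unfolding linepath_image_01[symmetric] by blast
  qed
  have v0: "e (pt j 0) (pt (Suc j) 0) = \<one>\<^bsub>G\<^esub>" and vn: "e (pt j n) (pt (Suc j) n) = \<one>\<^bsub>G\<^esub>" if "j < n" for j
  proof -
    show "e (pt j 0) (pt (Suc j) 0) = \<one>\<^bsub>G\<^esub>" unfolding e_def
    proof (rule G.path_functor_constant[OF FU pq(1)])
      show "(h \<circ> linepath (pt j 0) (pt (Suc j) 0)) t = pathstart p" if "t \<in> ?I" for t
        using inI[of j "Suc j" t] \<open>j < n\<close> that hl by (simp add: lin)
    qed
    show "e (pt j n) (pt (Suc j) n) = \<one>\<^bsub>G\<^esub>" unfolding e_def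
    proof (rule G.path_functor_constant[OF FU pq(2)])
      have "linepath (1::real) 1 t = 1" for t by (simp add: linepath_def)
      then show "(h \<circ> linepath (pt j n) (pt (Suc j) n)) t = pathfinish p" if "t \<in> ?I" for t
        using inI[of j "Suc j" t] \<open>j < n\<close> that hr n0 by (simp add: lin)
    qed
  qed
  have Wcl: "W j i \<in> carrier G" if "j < n" "i \<le> n" for j i
    using that(2)
  proof (induction i)
    case (Suc i)
    then show ?case
      using ecl[OF \<open>j < n\<close>, of i "pt j i" "pt j (Suc i)"] cell by (simp add: WS)
  qed (simp add: W0)
  have row: "W j i \<otimes>\<^bsub>G\<^esub> e (pt j i) (pt (Suc j) i) = W (Suc j) i" if "j < n" "i \<le> n" for i j
    using that(2)
  proof (induction i)
    case 0
    then show ?case using v0[OF \<open>j < n\<close>] by (simp add: W0)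
  next
    case (Suc i)
    let ?a = "pt j i" and ?b = "pt j (Suc i)" and ?c = "pt (Suc j) i" and ?d = "pt (Suc j) (Suc i)"
    note ab = \<open>j < n\<close> Suc_le_lessD[OF Suc.prems]
    note ec = ecl[OF ab]
    have cl: "e ?a ?b \<in> carrier G" "e ?b ?d \<in> carrier G" "e ?a ?c \<in> carrier G" "e ?c ?d \<in> carrier G"
      "W j i \<in> carrier G"
      using Wcl[OF \<open>j < n\<close>, of i] ab(2) cell by (simp_all add: ec)
    have "W j (Suc i) \<otimes>\<^bsub>G\<^esub> e ?b ?d = W j i \<otimes>\<^bsub>G\<^esub> (e ?a ?b \<otimes>\<^bsub>G\<^esub> e ?b ?d)"
      using cl by (simp add: WS G.m_assoc)
    also have "e ?a ?b \<otimes>\<^bsub>G\<^esub> e ?b ?d = e ?a ?c \<otimes>\<^bsub>G\<^esub> e ?c ?d"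
      using tri[OF ab] cell by metis
    also have "W j i \<otimes>\<^bsub>G\<^esub> \<dots> = W (Suc j) (Suc i)"
      using cl Suc by (simp add: WS flip: G.m_assoc)
    finally show ?case .
  qed
  have step: "W j n = W (Suc j) n" if "j < n" for j
    using row[OF that, of n] vn[OF that] Wcl[OF that, of n] by simp
  have W_eq: "W j n = W 0 n" if "j \<le> n" for j
    using that by (induction j) (auto simp: step)
  have edge: "W j n = F r" if j: "j \<le> n" and r: "path r" "path_image r \<subseteq> U"
    and hr: "\<And>t. t \<in> ?I \<Longrightarrow> h (real j / n, t) = r t" for j r
  proof -
    have cr: "continuous_on ?I r" "r ` ?I \<subseteq> U" using r by (auto simp: path_def path_image_def)
    have in01: "real i / n \<in> ?I" if "i \<le> n" for i using that n0 by auto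
    have "W j i = F (r \<circ> linepath 0 (real i / n))" if "i \<le> n" for i
      using that
    proof (induction i)
      case 0
      have "0 \<in> ?I" by simp
      then have "r 0 \<in> U" using cr(2) by blast
      then show ?case
        by (simp add: W0) (rule G.path_functor_constant[OF FU, symmetric], auto simp: linepath_def)
    next
      case (Suc i)
      have "e (pt j i) (pt j (Suc i)) = F (r \<circ> linepath (real i / n) (real (Suc i) / n))"
        unfolding e_def
      proof (rule path_functor_cong[OF FU])
        show "path (r \<circ> linepath (real i / n) (real (Suc i) / n))"
          "path_image (r \<circ> linepath (real i / n) (real (Suc i) / n)) \<subseteq> U"
          using segment_image[OF _ in01[of i] in01[of "Suc i"] cr] Suc.prems by simp_all
        fix t assume t: "t \<in> ?I"
        have "linepath (real j / n) (real j / n) t = real j / n"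
          by (simp add: linepath_refl)
        then show "(h \<circ> linepath (pt j i) (pt j (Suc i))) t = (r \<circ> linepath (real i / n) (real (Suc i) / n)) t"
          using inI[OF _ Suc.prems t, of i] Suc.prems hr by (simp add: lin del: of_nat_Suc)
      qed
      then have "W j (Suc i) = F (r \<circ> linepath 0 (real i / n)) \<otimes>\<^bsub>G\<^esub> F (r \<circ> linepath (real i / n) (real (Suc i) / n))"
        using Suc by (simp only: WS Suc_leD)
      also have "\<dots> = F (r \<circ> linepath 0 (real (Suc i) / n))"
        using in01[of i] in01[of "Suc i"] Suc.prems
        by (intro path_functor_convex[OF FU _ cr]) (auto simp del: of_nat_Suc)
      finally show ?case .
    qed
    moreover have "r \<circ> linepath 0 1 = r" by (auto simp: linepath_def fun_eq_iff)
    ultimately show ?thesis using n0 by simp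
  qed
  have "W 0 n = F p" by (rule edge) (use pp pU h01(1) in auto)
  moreover have "W n n = F q" by (rule edge) (use pp qU h01(2) n0 in auto)
  ultimately show ?thesis using W_eq[of n] by simp
qed

text \<open>The diagonal of the square is homotopic to both ways around it.\<close>

lemma path_functor_square:
  fixes g :: "real \<times> real \<Rightarrow> 'a::real_normed_vector"
  assumes F: "path_functor G U F"
    and g: "continuous_on ({0..1} \<times> {0..1}) g" "g ` ({0..1} \<times> {0..1}) \<subseteq> U"
  shows "F (\<lambda>t. g (0, t)) \<otimes>\<^bsub>G\<^esub> F (\<lambda>s. g (s, 1)) = F (\<lambda>s. g (s, 0)) \<otimes>\<^bsub>G\<^esub> F (\<lambda>t. g (1, t))"
proof -
  have C: "convex ({0..1::real} \<times> {0..1::real})" by (simp add: convex_Times)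
  have eqs: "g \<circ> linepath (0, 0) (0, 1) = (\<lambda>t. g (0, t))" "g \<circ> linepath (0, 1) (1, 1) = (\<lambda>s. g (s, 1))"
    "g \<circ> linepath (0, 0) (1, 0) = (\<lambda>s. g (s, 0))" "g \<circ> linepath (1, 0) (1, 1) = (\<lambda>t. g (1, t))"
    by (simp_all add: fun_eq_iff linepath_def)
  have "F (g \<circ> linepath (0, 0) (0, 1)) \<otimes>\<^bsub>G\<^esub> F (g \<circ> linepath (0, 1) (1, 1)) = F (g \<circ> linepath (0, 0) (1, 1))"
    by (rule path_functor_convex[OF F C g]) auto
  moreover have "F (g \<circ> linepath (0, 0) (1, 0)) \<otimes>\<^bsub>G\<^esub> F (g \<circ> linepath (1, 0) (1, 1)) = F (g \<circ> linepath (0, 0) (1, 1))"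
    by (rule path_functor_convex[OF F C g]) auto
  ultimately show ?thesis by (simp only: eqs)
qed

lemma path_functor_compose:
  assumes F: "path_functor G U F" and \<rho>: "continuous_on V \<rho>" "\<rho> ` V \<subseteq> U"
  shows "path_functor G V (\<lambda>p. F (\<rho> \<circ> p))"
proof -
  have im: "path (\<rho> \<circ> p)" "path_image (\<rho> \<circ> p) \<subseteq> U" if "path p" "path_image p \<subseteq> V" for p
  proof -
    show "path (\<rho> \<circ> p)"
      by (rule path_continuous_image[OF that(1) continuous_on_subset[OF \<rho>(1) that(2)]])
    show "path_image (\<rho> \<circ> p) \<subseteq> U" using that(2) \<rho>(2) unfolding path_image_compose by blast
  qed
  show ?thesis
    unfolding path_functor_def
  proof (intro conjI allI impI)
    show "F (\<rho> \<circ> p) \<in> carrier G" if "path p" "path_image p \<subseteq> V" for p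
      by (rule path_functor_closed[OF F im[OF that]])
    show "F (\<rho> \<circ> (p +++ q)) = F (\<rho> \<circ> p) \<otimes>\<^bsub>G\<^esub> F (\<rho> \<circ> q)"
      if "path p" "path_image p \<subseteq> V" "path q" "path_image q \<subseteq> V" "pathfinish p = pathstart q" for p q
      unfolding path_compose_join
      by (rule path_functor_join[OF F im[OF that(1,2)] im[OF that(3,4)]])
        (simp add: pathstart_compose pathfinish_compose that(5))
    show "F (\<rho> \<circ> p) = F (\<rho> \<circ> q)" if "homotopic_paths V p q" for p q
      by (rule path_functor_homotopic[OF F homotopic_paths_continuous_image[OF that \<rho>(1)]])
        (use \<rho>(2) in blast)
  qed
qed

lemma path_functor_transfer:
  assumes F: "path_functor G U F"
    and eq: "\<And>p. \<lbrakk>path p; path_image p \<subseteq> U\<rbrakk> \<Longrightarrow> F' p = F p"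
  shows "path_functor G U F'"
  unfolding path_functor_def
proof (intro conjI allI impI)
  show "F' p \<in> carrier G" if "path p" "path_image p \<subseteq> U" for p
    using path_functor_closed[OF F that] eq[OF that] by simp
  show "F' (p +++ q) = F' p \<otimes>\<^bsub>G\<^esub> F' q"
    if "path p" "path_image p \<subseteq> U" "path q" "path_image q \<subseteq> U" "pathfinish p = pathstart q" for p q
    using path_functor_join[OF F that] that by (simp add: eq path_image_join)
  show "F' p = F' q" if "homotopic_paths U p q" for p q
    using path_functor_homotopic[OF F that] eq homotopic_paths_imp_path[OF that] homotopic_paths_imp_subset[OF that]
    by simp
qed

text \<open>Changing the identification of the object \<open>x\<close> with the one object of \<open>G\<close> by \<open>e x\<close> gives a naturally
  isomorphic functor.\<close>

lemma path_functor_gauge: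
  assumes "group G" and F: "path_functor G U F" and e: "\<And>x. e x \<in> carrier G"
  shows "path_functor G U (\<lambda>p. inv\<^bsub>G\<^esub> (e (pathstart p)) \<otimes>\<^bsub>G\<^esub> F p \<otimes>\<^bsub>G\<^esub> e (pathfinish p))"
  unfolding path_functor_def
proof (intro conjI allI impI)
  interpret G: group G by fact
  show "inv\<^bsub>G\<^esub> (e (pathstart p)) \<otimes>\<^bsub>G\<^esub> F p \<otimes>\<^bsub>G\<^esub> e (pathfinish p) \<in> carrier G"
    if "path p" "path_image p \<subseteq> U" for p
    using path_functor_closed[OF F that] e by simp
  show "inv\<^bsub>G\<^esub> (e (pathstart (p +++ q))) \<otimes>\<^bsub>G\<^esub> F (p +++ q) \<otimes>\<^bsub>G\<^esub> e (pathfinish (p +++ q))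
      = (inv\<^bsub>G\<^esub> (e (pathstart p)) \<otimes>\<^bsub>G\<^esub> F p \<otimes>\<^bsub>G\<^esub> e (pathfinish p)) \<otimes>\<^bsub>G\<^esub>
        (inv\<^bsub>G\<^esub> (e (pathstart q)) \<otimes>\<^bsub>G\<^esub> F q \<otimes>\<^bsub>G\<^esub> e (pathfinish q))"
    if pq: "path p" "path_image p \<subseteq> U" "path q" "path_image q \<subseteq> U" "pathfinish p = pathstart q" for p q
  proof -
    have "x \<otimes>\<^bsub>G\<^esub> (inv\<^bsub>G\<^esub> x \<otimes>\<^bsub>G\<^esub> y) = y" if "x \<in> carrier G" "y \<in> carrier G" for x y
      using that by (simp flip: G.m_assoc)
    then show ?thesis
      using path_functor_closed[OF F pq(1,2)] path_functor_closed[OF F pq(3,4)] e pq(5)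
      by (simp add: path_functor_join[OF F pq] G.m_assoc)
  qed
  show "inv\<^bsub>G\<^esub> (e (pathstart p)) \<otimes>\<^bsub>G\<^esub> F p \<otimes>\<^bsub>G\<^esub> e (pathfinish p)
      = inv\<^bsub>G\<^esub> (e (pathstart q)) \<otimes>\<^bsub>G\<^esub> F q \<otimes>\<^bsub>G\<^esub> e (pathfinish q)"
    if "homotopic_paths U p q" for p q
    using path_functor_homotopic[OF F that] homotopic_paths_imp_pathstart[OF that]
      homotopic_paths_imp_pathfinish[OF that] by simp
qed

section \<open>Tubular neighbourhoods of a knot\<close>

lemma cis_eq_iff_near:
  assumes "cis a = cis b" "\<bar>a - b\<bar> < 2 * pi" shows "a = b"
proof -
  have "exp (\<i> * complex_of_real a) = exp (\<i> * complex_of_real b)"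
    using assms(1) by (simp add: cis_conv_exp)
  then obtain n :: int where "\<i> * complex_of_real a = \<i> * complex_of_real b + (of_int (2 * n) * pi) * \<i>"
    unfolding exp_eq by blast
  then have "Im (\<i> * complex_of_real a) = Im (\<i> * complex_of_real b + (of_int (2 * n) * pi) * \<i>)" by simp
  then have n: "a - b = 2 * pi * of_int n" by simp
  then have "2 * pi * \<bar>of_int n\<bar> < 2 * pi * (1::real)" using assms(2) by (simp add: abs_mult)
  then have "\<bar>of_int n :: real\<bar> < 1" by simp
  then have "n = 0" by linarith
  then show ?thesis using n by simp
qed

lemma cis_Arg_sphere:
  assumes "z \<in> sphere 0 1" shows "cis (Arg z) = z"
proof -
  have "norm z = 1" using assms by simp
  moreover from this have "z \<noteq> 0" by auto
  ultimately show ?thesis by (simp add: cis_Arg sgn_eq)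
qed

locale tubed_knot =
  fixes K :: "(real^4) set" and N :: "complex \<times> complex \<Rightarrow> real^4"
  assumes tube: "tubular_neighbourhood K N"
begin

abbreviation "solid_torus \<equiv> sphere (0::complex) 1 \<times> cball (0::complex) 1"

definition V :: "(real^4) set" where "V = N ` (sphere 0 1 \<times> ball 0 1)"

lemma contN: "continuous_on solid_torus N"
  and injN: "inj_on N solid_torus"
  and N_S3: "N ` solid_torus \<subseteq> S3"
  and N_core: "N ` (sphere 0 1 \<times> {0}) = K"
  using tube by (auto simp: tubular_neighbourhood_def)

lemma N_in_K_iff:
  assumes "z \<in> sphere 0 1" "w \<in> cball 0 1" shows "N (z, w) \<in> K \<longleftrightarrow> w = 0"
proof
  assume "N (z, w) \<in> K"
  then obtain y where y: "y \<in> sphere 0 1" "N (z, w) = N (y, 0)"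
    unfolding N_core[symmetric] by blast
  have "(z, w) = (y, 0)"
    by (rule inj_onD[OF injN y(2)]) (use y assms in auto)
  then show "w = 0" by simp
next
  assume "w = 0" then show "N (z, w) \<in> K" using assms unfolding N_core[symmetric] by blast
qed

lemma N_in_complement_iff:
  assumes "z \<in> sphere 0 1" "w \<in> cball 0 1" shows "N (z, w) \<in> S3 - K \<longleftrightarrow> w \<noteq> 0"
proof -
  have "N (z, w) \<in> S3" using N_S3 assms by blast
  then show ?thesis using N_in_K_iff[OF assms] by blast
qed

lemma openin_complement: "openin (top_of_set S3) (S3 - K)"
proof -
  have "compact K"
    unfolding N_core[symmetric]
    by (rule compact_continuous_image[OF continuous_on_subset[OF contN]]) (auto intro: compact_Times)
  then have "open (- K)" by (simp add: compact_imp_closed open_Compl)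
  then show ?thesis unfolding openin_open by (intro exI[of _ "- K"]) auto
qed

text \<open>Invariance of domain, in local coordinates: an angle around the knot and the disc coordinate
  make an open set of a 3-dimensional space, and the sphere minus one point is such a space.\<close>

lemma openin_V: "openin (top_of_set S3) V"
proof (subst openin_subopen, intro ballI)
  fix x assume "x \<in> V"
  then obtain z w where zw: "z \<in> sphere 0 1" "w \<in> ball 0 1" "x = N (z, w)" by (auto simp: V_def)
  define \<theta> where "\<theta> = Arg z"
  have z: "z = cis \<theta>" using cis_Arg_sphere[OF zw(1)] by (simp add: \<theta>_def)
  define D where "D = {\<theta> - pi<..<\<theta> + pi} \<times> ball (0::complex) 1"
  define g where "g = (\<lambda>(a, w). N (cis a, w))"
  \<comment> \<open>A point of the knot on the fibre opposite to z, outside the image of the chart.\<close>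
  define b where "b = N (cis (\<theta> + pi), 0)"
  have "open D" by (simp add: D_def open_Times)
  have D_torus: "(\<lambda>(a, w). (cis a, w)) ` D \<subseteq> solid_torus" by (auto simp: D_def)
  have contg: "continuous_on D g"
  proof -
    have "continuous_on D (N \<circ> (\<lambda>(a, w). (cis a, w)))"
      by (rule continuous_on_compose[OF _ continuous_on_subset[OF contN D_torus]])
        (auto simp: case_prod_unfold intro!: continuous_intros)
    then show ?thesis by (simp add: g_def comp_def case_prod_unfold)
  qed
  have injg: "inj_on g D"
  proof (rule inj_onI)
    fix u v assume uv: "u \<in> D" "v \<in> D" "g u = g v"
    have "(cis (fst u), snd u) = (cis (fst v), snd v)"
      by (rule inj_onD[OF injN]) (use uv in \<open>auto simp: g_def D_def case_prod_unfold\<close>)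
    then have eq: "cis (fst u) = cis (fst v)" "snd u = snd v" by auto
    have "fst u = fst v"
      by (rule cis_eq_iff_near[OF eq(1)]) (use uv in \<open>auto simp: D_def abs_less_iff\<close>)
    then show "u = v" using eq by (simp add: prod_eq_iff)
  qed
  have bS3: "b \<in> S3" unfolding b_def using N_S3 by (rule subsetD) auto
  have gS3: "g ` D \<subseteq> S3 - {b}"
  proof
    fix y assume "y \<in> g ` D"
    then obtain a u where u: "(a, u) \<in> D" "y = N (cis a, u)" by (auto simp: g_def)
    have "y \<in> S3" unfolding u(2) by (rule subsetD[OF N_S3]) (use u(1) in \<open>auto simp: D_def\<close>)
    moreover have "y \<noteq> b"
    proof
      assume "y = b"
      then have "(cis a, u) = (cis (\<theta> + pi), 0)"
        unfolding u(2) b_def by (rule inj_onD[OF injN]) (use u(1) in \<open>auto simp: D_def\<close>)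
      then have "cis a = cis (\<theta> + pi)" by simp
      then have "a = \<theta> + pi"
        by (rule cis_eq_iff_near) (use u(1) in \<open>auto simp: D_def abs_less_iff\<close>)
      then show False using u(1) by (simp add: D_def)
    qed
    ultimately show "y \<in> S3 - {b}" by blast
  qed
  have "(S3 - {b}) homeomorphic (UNIV :: (real \<times> complex) set)"
    by (rule homeomorphic_punctured_sphere_affine) (use bS3 in auto)
  then obtain \<phi> \<psi> where hom: "homeomorphism (S3 - {b}) (UNIV :: (real \<times> complex) set) \<phi> \<psi>"
    unfolding homeomorphic_def by blast
  have cont\<phi>: "continuous_on (S3 - {b}) \<phi>" and inv\<phi>: "\<And>y. y \<in> S3 - {b} \<Longrightarrow> \<psi> (\<phi> y) = y"
    using hom by (auto simp: homeomorphism_def)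
  have inj\<phi>: "inj_on \<phi> (S3 - {b})" by (rule inj_on_inverseI[where g = \<psi>]) (rule inv\<phi>)
  have op: "open ((\<phi> \<circ> g) ` D)"
  proof (rule invariance_of_domain[OF _ \<open>open D\<close>])
    show "continuous_on D (\<phi> \<circ> g)"
      by (rule continuous_on_compose[OF contg continuous_on_subset[OF cont\<phi> gS3]])
    show "inj_on (\<phi> \<circ> g) D" by (rule comp_inj_on[OF injg inj_on_subset[OF inj\<phi> gS3]])
  qed
  have "g ` D = (S3 - {b}) \<inter> \<phi> -` ((\<phi> \<circ> g) ` D)"
  proof
    show "g ` D \<subseteq> (S3 - {b}) \<inter> \<phi> -` ((\<phi> \<circ> g) ` D)" using gS3 by auto
    show "(S3 - {b}) \<inter> \<phi> -` ((\<phi> \<circ> g) ` D) \<subseteq> g ` D"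
    proof
      fix y assume y: "y \<in> (S3 - {b}) \<inter> \<phi> -` ((\<phi> \<circ> g) ` D)"
      then obtain d where d: "d \<in> D" "\<phi> y = \<phi> (g d)" by auto
      have "y = g d" by (rule inj_onD[OF inj\<phi> d(2)]) (use y d(1) gS3 in auto)
      then show "y \<in> g ` D" using d(1) by blast
    qed
  qed
  then have "openin (top_of_set (S3 - {b})) (g ` D)"
    using continuous_openin_preimage_gen[OF cont\<phi> op] by simp
  moreover have "openin (top_of_set S3) (S3 - {b})"
    by (rule openin_delete) simp
  ultimately have "openin (top_of_set S3) (g ` D)" by (rule openin_trans)
  moreover have "x \<in> g ` D"
    by (rule image_eqI[of _ _ "(\<theta>, w)"]) (use zw z in \<open>auto simp: g_def D_def\<close>)
  moreover have "g ` D \<subseteq> V" by (auto simp: g_def D_def V_def)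
  ultimately show "\<exists>T. openin (top_of_set S3) T \<and> x \<in> T \<and> T \<subseteq> V" by blast
qed

abbreviation "U \<equiv> S3 - K"

text \<open>Tube coordinates: the angular position along the knot and the place in the fibre disc.\<close>

definition J :: "real^4 \<Rightarrow> complex \<times> complex" where "J = inv_into solid_torus N"

lemma J_N: "\<lbrakk>z \<in> sphere 0 1; w \<in> cball 0 1\<rbrakk> \<Longrightarrow> J (N (z, w)) = (z, w)"
  unfolding J_def by (rule inv_into_f_f[OF injN]) auto

lemma cont_J: "continuous_on V J"
proof -
  have "continuous_on (N ` solid_torus) J"
    by (rule continuous_on_inv[OF contN]) (auto intro: compact_Times simp: J_N)
  then show ?thesis by (rule continuous_on_subset) (auto simp: V_def)
qed

lemma V_cases:
  assumes "x \<in> V"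
  shows "fst (J x) \<in> sphere 0 1" "snd (J x) \<in> ball 0 1" "N (J x) = x"
proof -
  obtain z w where zw: "z \<in> sphere 0 1" "w \<in> ball 0 1" "x = N (z, w)"
    using assms by (auto simp: V_def)
  then have "J x = (z, w)" using J_N[of z w] by simp
  then show "fst (J x) \<in> sphere 0 1" "snd (J x) \<in> ball 0 1" "N (J x) = x" using zw by auto
qed

lemma V_minus_K_iff:
  assumes "x \<in> V" shows "x \<in> U \<longleftrightarrow> snd (J x) \<noteq> 0"
  using N_in_complement_iff[of "fst (J x)" "snd (J x)"] V_cases[OF assms] by simp

text \<open>The projection of the open tube to a parallel of the knot. It maps the tube, including the knot,
  into the complement, and so pulls a functor on the complement back to the tube.\<close>

definition to_longitude :: "real^4 \<Rightarrow> real^4" where "to_longitude x = N (fst (J x), 1)"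

lemma cont_N_compose:
  assumes "continuous_on A u" "continuous_on A v"
    and "\<And>x. x \<in> A \<Longrightarrow> u x \<in> sphere 0 1" "\<And>x. x \<in> A \<Longrightarrow> v x \<in> cball 0 1"
  shows "continuous_on A (\<lambda>x. N (u x, v x))"
  by (rule continuous_on_compose2[OF contN continuous_on_Pair[OF assms(1,2)]])
    (use assms(3,4) in blast)

lemma to_longitude: "continuous_on V to_longitude" "to_longitude ` V \<subseteq> U"
proof -
  show "continuous_on V to_longitude"
    unfolding to_longitude_def
    by (intro cont_N_compose continuous_intros continuous_on_fst cont_J) (use V_cases(1) in auto)
  show "to_longitude ` V \<subseteq> U"
  proof
    fix y assume "y \<in> to_longitude ` V"
    then obtain x where "x \<in> V" "y = N (fst (J x), 1)" by (auto simp: to_longitude_def)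
    then show "y \<in> U" using N_in_complement_iff[of "fst (J x)" 1] V_cases(1) by simp
  qed
qed

text \<open>The exponential map covers a punctured fibre disc by the closed left half plane. Its convexity
  replaces the winding number: the meridian circle lifts to a segment from \<open>0\<close> to \<open>2\<pi>i\<close>.\<close>

definition fibre :: "complex \<Rightarrow> complex \<Rightarrow> real^4" where "fibre z a = N (z, exp a)"

lemma fibre:
  assumes z: "z \<in> sphere 0 1"
  shows "continuous_on {a. Re a \<le> 0} (fibre z)" "fibre z ` {a. Re a \<le> 0} \<subseteq> U"
proof -
  have in1: "exp a \<in> cball 0 1" if "Re a \<le> 0" for a :: complex using that by simp
  show "continuous_on {a. Re a \<le> 0} (fibre z)"
    unfolding fibre_def by (intro cont_N_compose continuous_intros) (use z in1 in auto)
  show "fibre z ` {a. Re a \<le> 0} \<subseteq> U"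
    using N_in_complement_iff[OF z in1] by (auto simp: fibre_def)
qed

lemma meridian_circle_fibre: "meridian_circle N z = fibre z \<circ> linepath 0 (2 * pi * \<i>)"
  by (simp add: fun_eq_iff meridian_circle_def fibre_def linepath_def cis_conv_exp scaleR_conv_of_real mult_ac)

end

locale meridian_killing = tubed_knot + group G for G (structure) +
  fixes F
  assumes F: "path_functor G (S3 - K) F"
    and kill: "z \<in> sphere 0 1 \<Longrightarrow> F (meridian_circle N z) = \<one>\<^bsub>G\<^esub>"
begin

lemma fibre_tri:
  assumes "z \<in> sphere 0 1" "Re a \<le> 0" "Re b \<le> 0" "Re c \<le> 0"
  shows "F (fibre z \<circ> linepath a b) \<otimes> F (fibre z \<circ> linepath b c) = F (fibre z \<circ> linepath a c)"
proof (rule path_functor_convex[OF F _ fibre[OF assms(1)]])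
  show "convex {a. Re a \<le> 0}" by (rule convex_halfspace_Re_le)
qed (use assms in auto)

lemma fibre_closed:
  assumes "z \<in> sphere 0 1" "Re a \<le> 0" "Re b \<le> 0"
  shows "F (fibre z \<circ> linepath a b) \<in> carrier G"
  by (intro path_functor_closed[OF F] segment_image[OF _ _ _ fibre[OF assms(1)]])
    (use assms in \<open>auto intro: convex_halfspace_Re_le\<close>)

lemma spoke_shift:
  assumes z: "z \<in> sphere 0 1" and a: "Re a \<le> 0"
  shows "F (fibre z \<circ> linepath (a + 2 * pi * \<i>) 0) = F (fibre z \<circ> linepath a 0)"
proof -
  let ?c = "2 * complex_of_real pi * \<i>"
  have "fibre z \<circ> linepath (a + ?c) (0 + ?c) = fibre z \<circ> linepath a 0"
  proof
    fix t
    have "linepath (a + ?c) (0 + ?c) t = linepath a 0 t + ?c"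
      by (simp add: linepath_def algebra_simps scaleR_conv_of_real)
    then show "(fibre z \<circ> linepath (a + ?c) (0 + ?c)) t = (fibre z \<circ> linepath a 0) t"
      by (simp add: fibre_def exp_add)
  qed
  moreover have "F (fibre z \<circ> linepath ?c 0) = \<one>"
  proof -
    have "F (fibre z \<circ> linepath 0 ?c) \<otimes> F (fibre z \<circ> linepath ?c 0) = F (fibre z \<circ> linepath 0 0)"
      by (rule fibre_tri[OF z]) auto
    also have "\<dots> = \<one>"
      using fibre_tri[OF z, of 0 0 0] fibre_closed[OF z, of 0 0] l_cancel_one by auto
    finally show ?thesis
      using kill[OF z] fibre_closed[OF z, of ?c 0] by (simp add: meridian_circle_fibre)
  qed
  ultimately show ?thesis
    using fibre_tri[OF z, of "a + ?c" "0 + ?c" 0] fibre_closed[OF z, of a 0] a by simp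
qed

text \<open>Two logarithms of a point of the punctured disc differ by a multiple of \<open>2\<pi>i\<close>. The two paths to the
  boundary point \<open>1\<close> that they define therefore differ by meridian circles, which \<open>F\<close> kills.\<close>

lemma spoke_unique:
  assumes z: "z \<in> sphere 0 1" and ab: "Re a \<le> 0" "Re b \<le> 0" "exp a = exp b"
  shows "F (fibre z \<circ> linepath a 0) = F (fibre z \<circ> linepath b 0)"
proof -
  have nat: "F (fibre z \<circ> linepath (a + of_nat n * (2 * pi * \<i>)) 0) = F (fibre z \<circ> linepath a 0)"
    if "Re a \<le> 0" for a n
  proof (induction n)
    case (Suc n)
    have "a + of_nat (Suc n) * (2 * pi * \<i>) = (a + of_nat n * (2 * pi * \<i>)) + 2 * pi * \<i>"
      by (simp add: algebra_simps)
    moreover have "Re (a + of_nat n * (2 * pi * \<i>)) \<le> 0" using that by simp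
    ultimately show ?case using spoke_shift[OF z] Suc by presburger
  qed simp
  obtain k :: int where k: "a = b + (of_int (2 * k) * pi) * \<i>"
    using ab(3) unfolding exp_eq by blast
  show ?thesis
  proof (cases "k \<ge> 0")
    case True
    then have "a = b + of_nat (nat k) * (2 * pi * \<i>)" unfolding k by (simp add: mult_ac)
    then show ?thesis using nat[OF ab(2), of "nat k"] by simp
  next
    case False
    then have "b = a + of_nat (nat (- k)) * (2 * pi * \<i>)" unfolding k by (simp add: algebra_simps)
    then show ?thesis using nat[OF ab(1), of "nat (- k)"] by simp
  qed
qed

text \<open>The value of \<open>F\<close> on a path from \<open>x\<close> to the parallel inside a fibre of the punctured tube. Off
  the punctured tube there is nothing to compare, and the value is one.\<close>

definition twist :: "real^4 \<Rightarrow> 'a" where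
  "twist x = (if x \<in> V \<inter> U then F (fibre (fst (J x)) \<circ> linepath (Ln (snd (J x))) 0) else \<one>)"

lemma Re_Ln_le:
  assumes "w \<in> ball 0 1" "w \<noteq> 0" shows "Re (Ln w) \<le> 0"
  using assms by simp

lemma twist_closed [simp]: "twist x \<in> carrier G"
  using V_cases[of x] V_minus_K_iff[of x] by (auto simp: twist_def intro!: fibre_closed)

lemma twist_eq:
  assumes x: "x \<in> V" and a: "exp a = snd (J x)"
  shows "twist x = F (fibre (fst (J x)) \<circ> linepath a 0)"
proof -
  have ne: "snd (J x) \<noteq> 0" using a by (metis exp_not_eq_zero)
  have "norm (exp a) < 1" using V_cases(2)[OF x] unfolding a by simp
  then have "Re a \<le> 0" by (simp)
  moreover have "Re (Ln (snd (J x))) \<le> 0" using V_cases(2)[OF x] ne by (intro Re_Ln_le)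
  ultimately show ?thesis
    using V_cases(1)[OF x] V_minus_K_iff[OF x] x ne a
    by (auto simp: twist_def intro!: spoke_unique)
qed

text \<open>Take a continuous logarithm of the disc coordinate along \<open>p\<close> and shrink it to \<open>0\<close>. This slides \<open>p\<close>
  to its projection on the parallel, without meeting the knot, while the ends move along
  fibres.\<close>

lemma push_out:
  assumes p: "path p" "path_image p \<subseteq> V" "path_image p \<subseteq> U"
  shows "F p \<otimes> twist (pathfinish p) = twist (pathstart p) \<otimes> F (to_longitude \<circ> p)"
proof -
  let ?I = "{0..1::real}"
  have pV: "p t \<in> V" "p t \<in> U" if "t \<in> ?I" for t
    using p(2,3) that unfolding path_image_def by blast+
  have contJ: "continuous_on ?I (\<lambda>t. J (p t))"
    by (rule continuous_on_compose2[OF cont_J]) (use p(1) pV in \<open>auto simp: path_def\<close>)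
  obtain l where l: "continuous_on ?I l" "\<And>t. t \<in> ?I \<Longrightarrow> snd (J (p t)) = exp (l t)"
  proof (rule continuous_logarithm_on_contractible)
    show "continuous_on ?I (\<lambda>t. snd (J (p t)))" by (intro continuous_on_snd contJ)
    show "contractible ?I" by (simp add: convex_imp_contractible)
    show "snd (J (p t)) \<noteq> 0" if "t \<in> ?I" for t using V_minus_K_iff pV[OF that] by blast
  qed blast
  have Rel: "Re (l t) \<le> 0" if "t \<in> ?I" for t
  proof -
    have "norm (exp (l t)) < 1" using V_cases(2)[OF pV(1)[OF that]] l(2)[OF that] by simp
    then show ?thesis by simp
  qed
  define g where "g = (\<lambda>x. N (fst (J (p (snd x))), exp ((1 - fst x) *\<^sub>R l (snd x))))"
  have in1: "exp ((1 - s) *\<^sub>R l t) \<in> cball 0 1" if "s \<in> ?I" "t \<in> ?I" for s t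
    using Rel[OF that(2)] that(1) by (simp add: mult_nonneg_nonpos)
  have contg: "continuous_on (?I \<times> ?I) g"
    unfolding g_def
    by (intro cont_N_compose continuous_on_fst continuous_intros
        continuous_on_compose2[OF contJ] continuous_on_compose2[OF l(1)])
      (use in1 pV V_cases(1) in auto)
  have gU: "g ` (?I \<times> ?I) \<subseteq> U"
  proof
    fix y assume "y \<in> g ` (?I \<times> ?I)"
    then obtain s t where st: "s \<in> ?I" "t \<in> ?I" "y = N (fst (J (p t)), exp ((1 - s) *\<^sub>R l t))"
      by (auto simp: g_def)
    show "y \<in> U"
      unfolding st(3) using N_in_complement_iff[OF V_cases(1)[OF pV(1)[OF st(2)]] in1[OF st(1,2)]] by simp
  qed
  have left: "F (\<lambda>t. g (0, t)) = F p"
  proof (rule path_functor_cong[OF F p(1,3)])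
    show "g (0, t) = p t" if "t \<in> ?I" for t
      using V_cases(3)[OF pV(1)[OF that]] by (simp add: g_def flip: l(2)[OF that])
  qed
  have right: "F (\<lambda>t. g (1, t)) = F (to_longitude \<circ> p)"
    by (simp add: g_def to_longitude_def comp_def)
  have ends: "F (\<lambda>s. g (s, t)) = twist (p t)" if t: "t \<in> ?I" for t
  proof -
    have "(\<lambda>s. g (s, t)) = fibre (fst (J (p t))) \<circ> linepath (l t) 0"
      by (simp add: g_def fun_eq_iff fibre_def linepath_def)
    then show ?thesis using twist_eq[OF pV(1)[OF t] l(2)[OF t, symmetric]] by simp
  qed
  show ?thesis
    using path_functor_square[OF F contg gU] ends[of 0] ends[of 1]
    by (simp add: left right pathstart_def pathfinish_def)
qed

text \<open>After the change of identification by \<open>twist\<close>, the functor on the complement agrees on the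
  punctured tube with the pullback of \<open>F\<close> along \<open>to_longitude\<close>. Both together are invariant under
  homotopies in the whole 3-sphere, where every loop contracts.\<close>

lemma trivial_on_loops:
  assumes p: "path p" "path_image p \<subseteq> U" "pathfinish p = pathstart p"
  shows "F p = \<one>"
proof -
  let ?T = "\<lambda>p. inv (twist (pathstart p)) \<otimes> F p \<otimes> twist (pathfinish p)"
  \<comment> \<open>On U the gauged F, on the rest of the tube F after projection; on the punctured tube both agree.\<close>
  define \<Phi> where "\<Phi> p = (if path_image p \<subseteq> U then ?T p else F (to_longitude \<circ> p))" for p
  have "group G" by unfold_locales
  have FT: "path_functor G U ?T" by (rule path_functor_gauge[OF \<open>group G\<close> F]) simp
  have \<Phi>U: "path_functor G U \<Phi>"
    by (rule path_functor_transfer[OF FT]) (simp add: \<Phi>_def)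
  have FV: "path_functor G V (\<lambda>p. F (to_longitude \<circ> p))"
    by (rule path_functor_compose[OF F to_longitude])
  have \<Phi>V: "path_functor G V \<Phi>"
  proof (rule path_functor_transfer[OF FV])
    fix q assume q: "path q" "path_image q \<subseteq> V"
    show "\<Phi> q = F (to_longitude \<circ> q)"
    proof (cases "path_image q \<subseteq> U")
      case True
      have cl: "F q \<in> carrier G" "F (to_longitude \<circ> q) \<in> carrier G"
        using path_functor_closed[OF F q(1) True] path_functor_closed[OF FV q] by auto
      have "?T q = inv (twist (pathstart q)) \<otimes> (F q \<otimes> twist (pathfinish q))"
        using cl by (simp add: m_assoc)
      also have "\<dots> = F (to_longitude \<circ> q)"
        unfolding push_out[OF q True] using cl by (simp flip: m_assoc)
      finally show ?thesis using True by (simp add: \<Phi>_def)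
    qed (simp add: \<Phi>_def)
  qed
  have cover: "S3 \<subseteq> U \<union> V"
  proof
    fix x assume "x \<in> S3"
    moreover have "K \<subseteq> V" unfolding V_def N_core[symmetric] by auto
    ultimately show "x \<in> U \<union> V" by blast
  qed
  have "simply_connected S3" by (rule simply_connected_sphere) simp
  then have null: "homotopic_paths S3 p (linepath (pathstart p) (pathstart p))"
    using p unfolding simply_connected_eq_contractible_path by blast
  have x: "pathstart p \<in> U" using p(2) pathstart_in_path_image by blast
  have "\<Phi> p = \<Phi> (linepath (pathstart p) (pathstart p))"
    by (rule path_functor_two_open_sets[OF \<open>group G\<close> \<Phi>U \<Phi>V openin_complement openin_V cover null p(2)])
      (use x in simp)
  also have "\<dots> = \<one>" by (rule path_functor_linepath_refl[OF \<Phi>U x])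
  finally have "inv (twist (pathstart p)) \<otimes> F p \<otimes> twist (pathstart p) = \<one>"
    using p by (simp add: \<Phi>_def)
  moreover have "F p \<in> carrier G" by (rule path_functor_closed[OF F p(1,2)])
  ultimately show ?thesis
    by (metis inv_closed inv_equality inv_inv inv_solve_left' m_closed r_inv r_one twist_closed)
qed

end

text \<open>The knot group is normally generated by the meridians. The extension of \<open>f\<close> to the groupoid kills the
  fibre circles: a circle that the base point can reach is, up to conjugation, a meridian, and on the
  others the extension is constant.\<close>

theorem hom_trivial_if_kills_meridians:
  assumes tube: "tubular_neighbourhood K N" and x\<^sub>0: "x\<^sub>0 \<in> S3 - K"
    and "group G" and f: "f \<in> hom (knot_group K x\<^sub>0) G"
    and kill: "\<And>m. m \<in> meridians K N x\<^sub>0 \<Longrightarrow> f m = \<one>\<^bsub>G\<^esub>"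
    and g: "g \<in> carrier (knot_group K x\<^sub>0)"
  shows "f g = \<one>\<^bsub>G\<^esub>"
proof -
  interpret G: group G by fact
  interpret tubed_knot K N by unfold_locales fact
  obtain F where F: "path_functor G U F"
    and loops: "\<And>p. p \<in> based_loops U x\<^sub>0 \<Longrightarrow> F p = f (path_class U p)"
    and far: "\<And>p. \<lbrakk>path p; path_image p \<subseteq> U; \<not> path_component U x\<^sub>0 (pathstart p)\<rbrakk> \<Longrightarrow> F p = \<one>\<^bsub>G\<^esub>"
    using extend_hom_to_groupoid[OF \<open>group G\<close> f[unfolded knot_group_def] x\<^sub>0] by blast
  have circle: "F (meridian_circle N z) = \<one>\<^bsub>G\<^esub>" if z: "z \<in> sphere 0 1" for z
  proof -
    let ?c = "meridian_circle N z"
    have c: "path ?c" "path_image ?c \<subseteq> U"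
      unfolding meridian_circle_fibre
      by (rule segment_image[OF convex_halfspace_Re_le[of 0] _ _ fibre[OF z]]; simp)+
    have ends: "pathstart ?c = N (z, 1)" "pathfinish ?c = N (z, 1)"
      by (simp_all add: meridian_circle_def pathstart_def pathfinish_def)
    show ?thesis
    proof (cases "path_component U x\<^sub>0 (N (z, 1))")
      case True
      then obtain \<gamma> where \<gamma>: "path \<gamma>" "path_image \<gamma> \<subseteq> U" "pathstart \<gamma> = x\<^sub>0" "pathfinish \<gamma> = N (z, 1)"
        unfolding path_component_def by blast
      let ?m = "\<gamma> +++ ?c +++ reversepath \<gamma>"
      have "?m \<in> based_loops U x\<^sub>0" using \<gamma> c ends by (simp add: based_loops_def path_image_join)
      moreover have "path_class U ?m \<in> meridians K N x\<^sub>0" unfolding meridians_def using z \<gamma> by blast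
      ultimately have "F ?m = \<one>\<^bsub>G\<^esub>" using loops kill by simp
      moreover have "F ?m = F \<gamma> \<otimes>\<^bsub>G\<^esub> (F ?c \<otimes>\<^bsub>G\<^esub> inv\<^bsub>G\<^esub> (F \<gamma>))"
        using \<gamma> c ends
        by (simp add: path_functor_join[OF F] path_image_join G.path_functor_reversepath[OF F])
      ultimately have conj: "F \<gamma> \<otimes>\<^bsub>G\<^esub> (F ?c \<otimes>\<^bsub>G\<^esub> inv\<^bsub>G\<^esub> (F \<gamma>)) = \<one>\<^bsub>G\<^esub>" by simp
      have cl: "F \<gamma> \<in> carrier G" "F ?c \<in> carrier G"
        using path_functor_closed[OF F \<gamma>(1,2)] path_functor_closed[OF F c] by auto
      have "inv\<^bsub>G\<^esub> (F \<gamma>) \<otimes>\<^bsub>G\<^esub> (F \<gamma> \<otimes>\<^bsub>G\<^esub> (F ?c \<otimes>\<^bsub>G\<^esub> inv\<^bsub>G\<^esub> (F \<gamma>))) \<otimes>\<^bsub>G\<^esub> F \<gamma>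
          = (inv\<^bsub>G\<^esub> (F \<gamma>) \<otimes>\<^bsub>G\<^esub> F \<gamma>) \<otimes>\<^bsub>G\<^esub> F ?c \<otimes>\<^bsub>G\<^esub> (inv\<^bsub>G\<^esub> (F \<gamma>) \<otimes>\<^bsub>G\<^esub> F \<gamma>)"
        using cl by (simp only: G.m_assoc G.m_closed G.inv_closed)
      then show ?thesis unfolding conj using cl by simp
    next
      case False
      then show ?thesis using far[OF c] ends by simp
    qed
  qed
  interpret meridian_killing K N G F by unfold_locales (use F circle in auto)
  obtain p where "p \<in> based_loops U x\<^sub>0" "g = path_class U p"
    using g by (auto simp: knot_group_def fundamental_group_def)
  then show ?thesis using loops trivial_on_loops by (simp add: based_loops_def)
qed

text \<open>The fibre circles over an arc of the knot form a homotopy between the circles over its ends; the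
  path swept out by their base points conjugates the meridians.\<close>

theorem meridians_conjugate:
  assumes tube: "tubular_neighbourhood K N" and x\<^sub>0: "x\<^sub>0 \<in> S3 - K"
    and m: "m \<in> meridians K N x\<^sub>0" and m': "m' \<in> meridians K N x\<^sub>0"
  shows "m \<in> conjugates (knot_group K x\<^sub>0) m'"
proof -
  interpret tubed_knot K N by unfold_locales fact
  let ?P = "knot_group K x\<^sub>0"
  have grP: "group ?P" unfolding knot_group_def by (rule group_fundamental_group[OF x\<^sub>0])
  interpret P: group ?P by fact
  have id: "(\<lambda>x. x) \<in> hom (fundamental_group U x\<^sub>0) ?P" by (simp add: knot_group_def hom_def)
  obtain F where F: "path_functor ?P U F" and loops: "\<And>p. p \<in> based_loops U x\<^sub>0 \<Longrightarrow> F p = path_class U p"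
    by (rule extend_hom_to_groupoid[OF grP id x\<^sub>0]) (rule that)
  have c: "path (meridian_circle N z)" "path_image (meridian_circle N z) \<subseteq> U"
    "pathstart (meridian_circle N z) = N (z, 1)" "pathfinish (meridian_circle N z) = N (z, 1)"
    if z: "z \<in> sphere 0 1" for z
  proof -
    show "path (meridian_circle N z)" "path_image (meridian_circle N z) \<subseteq> U"
      unfolding meridian_circle_fibre
      by (rule segment_image[OF convex_halfspace_Re_le[of 0] _ _ fibre[OF z]]; simp)+
  qed (simp_all add: meridian_circle_def pathstart_def pathfinish_def)
  have F_meridian: "\<exists>\<gamma> z. z \<in> sphere 0 1 \<and> path \<gamma> \<and> path_image \<gamma> \<subseteq> U \<and>
      m = F \<gamma> \<otimes>\<^bsub>?P\<^esub> (F (meridian_circle N z) \<otimes>\<^bsub>?P\<^esub> inv\<^bsub>?P\<^esub> (F \<gamma>))" if "m \<in> meridians K N x\<^sub>0" for m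
  proof -
    obtain \<gamma> z where m: "m = path_class U (\<gamma> +++ meridian_circle N z +++ reversepath \<gamma>)"
      and z: "z \<in> sphere 0 1" and \<gamma>: "path \<gamma>" "path_image \<gamma> \<subseteq> U"
        "pathstart \<gamma> = x\<^sub>0" "pathfinish \<gamma> = N (z, 1)"
      using \<open>m \<in> meridians K N x\<^sub>0\<close> unfolding meridians_def by blast
    have "\<gamma> +++ meridian_circle N z +++ reversepath \<gamma> \<in> based_loops U x\<^sub>0"
      using \<gamma> c[OF z] by (simp add: based_loops_def path_image_join)
    then have "m = F (\<gamma> +++ meridian_circle N z +++ reversepath \<gamma>)" unfolding m by (rule loops[symmetric])
    also have "\<dots> = F \<gamma> \<otimes>\<^bsub>?P\<^esub> (F (meridian_circle N z) \<otimes>\<^bsub>?P\<^esub> inv\<^bsub>?P\<^esub> (F \<gamma>))"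
      using \<gamma> c[OF z]
      by (simp add: path_functor_join[OF F] path_image_join P.path_functor_reversepath[OF F])
    finally show ?thesis using z \<gamma>(1,2) by (intro exI[of _ \<gamma>] exI[of _ z] conjI)
  qed
  obtain \<gamma> z where z: "z \<in> sphere 0 1" and \<gamma>: "path \<gamma>" "path_image \<gamma> \<subseteq> U"
    and m: "m = F \<gamma> \<otimes>\<^bsub>?P\<^esub> (F (meridian_circle N z) \<otimes>\<^bsub>?P\<^esub> inv\<^bsub>?P\<^esub> (F \<gamma>))"
    using F_meridian[OF m] by (elim exE conjE)
  obtain \<gamma>' z' where z': "z' \<in> sphere 0 1" and \<gamma>': "path \<gamma>'" "path_image \<gamma>' \<subseteq> U"
    and m': "m' = F \<gamma>' \<otimes>\<^bsub>?P\<^esub> (F (meridian_circle N z') \<otimes>\<^bsub>?P\<^esub> inv\<^bsub>?P\<^esub> (F \<gamma>'))"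
    using F_meridian[OF m'] by (elim exE conjE)
  have zz: "cis (Arg z) = z" "cis (Arg z') = z'"
    using z z' by (simp_all add: cis_Arg_sphere del: mem_sphere)
  define g where "g = (\<lambda>x. N (cis (linepath (Arg z) (Arg z') (fst x)), cis (2 * pi * snd x)))"
  have gN: "continuous_on ({0..1} \<times> {0..1}) g" "g ` ({0..1} \<times> {0..1}) \<subseteq> U"
  proof -
    show "continuous_on ({0..1} \<times> {0..1}) g"
      unfolding g_def linepath_def by (intro cont_N_compose continuous_intros) auto
    show "g ` ({0..1} \<times> {0..1}) \<subseteq> U"
      unfolding g_def using N_in_complement_iff[of "cis a" "cis b" for a b] by auto
  qed
  have sq: "F (\<lambda>t. g (0, t)) \<otimes>\<^bsub>?P\<^esub> F (\<lambda>s. g (s, 1)) = F (\<lambda>s. g (s, 0)) \<otimes>\<^bsub>?P\<^esub> F (\<lambda>t. g (1, t))"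
    by (rule path_functor_square[OF F gN])
  have sides: "(\<lambda>t. g (0, t)) = meridian_circle N z" "(\<lambda>t. g (1, t)) = meridian_circle N z'"
    "(\<lambda>s. g (s, 1)) = (\<lambda>s. g (s, 0))"
    using zz by (simp_all add: g_def meridian_circle_def linepath_def fun_eq_iff)
  define l where "l = F (\<lambda>s. g (s, 0))"
  have lcl: "l \<in> carrier ?P"
  proof -
    have eq: "(\<lambda>s. g (s, 0)) = g \<circ> linepath (0, 0) (1, 0)" by (simp add: fun_eq_iff linepath_def)
    show ?thesis
      unfolding l_def eq
      by (intro path_functor_closed[OF F] segment_image[OF _ _ _ gN]) (auto simp: convex_Times)
  qed
  let ?a = "F (meridian_circle N z)" and ?b = "F (meridian_circle N z')"
  have al: "?a \<otimes>\<^bsub>?P\<^esub> l = l \<otimes>\<^bsub>?P\<^esub> ?b" using sq by (simp add: sides l_def)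
  have cl: "F \<gamma> \<in> carrier ?P" "F \<gamma>' \<in> carrier ?P" "?a \<in> carrier ?P" "?b \<in> carrier ?P"
    using path_functor_closed[OF F] \<gamma> \<gamma>' c[OF z] c[OF z'] by auto
  have can: "inv\<^bsub>?P\<^esub> x \<otimes>\<^bsub>?P\<^esub> (x \<otimes>\<^bsub>?P\<^esub> y) = y" if "x \<in> carrier ?P" "y \<in> carrier ?P" for x y
    using that by (simp flip: P.m_assoc)
  have a: "?a = l \<otimes>\<^bsub>?P\<^esub> ?b \<otimes>\<^bsub>?P\<^esub> inv\<^bsub>?P\<^esub> l"
    using al cl lcl by (metis P.inv_solve_right P.m_closed)
  let ?x = "F \<gamma> \<otimes>\<^bsub>?P\<^esub> l \<otimes>\<^bsub>?P\<^esub> inv\<^bsub>?P\<^esub> (F \<gamma>')"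
  have "m = ?x \<otimes>\<^bsub>?P\<^esub> m' \<otimes>\<^bsub>?P\<^esub> inv\<^bsub>?P\<^esub> ?x"
    unfolding m m' a using cl lcl by (simp add: P.m_assoc P.inv_mult_group can)
  moreover have "?x \<in> carrier ?P" using cl lcl by simp
  ultimately show ?thesis unfolding conjugates_def by blast
qed

section \<open>Homomorphisms out of the braid group\<close>

definition braid_letter :: "('g, 'm) monoid_scheme \<Rightarrow> 'g \<Rightarrow> 'g \<Rightarrow> artin_gen \<times> bool \<Rightarrow> 'g" where
  "braid_letter G a b l =
     (let g = (case fst l of Gen1 \<Rightarrow> a | Gen2 \<Rightarrow> b) in if snd l then g else inv\<^bsub>G\<^esub> g)"

definition braid_eval :: "('g, 'm) monoid_scheme \<Rightarrow> 'g \<Rightarrow> 'g \<Rightarrow> braid_word \<Rightarrow> 'g" where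
  "braid_eval G a b w = foldr (\<lambda>l g. braid_letter G a b l \<otimes>\<^bsub>G\<^esub> g) w \<one>\<^bsub>G\<^esub>"

lemma (in group) braid_letter_closed [simp]:
  "\<lbrakk>a \<in> carrier G; b \<in> carrier G\<rbrakk> \<Longrightarrow> braid_letter G a b l \<in> carrier G"
  by (auto simp: braid_letter_def Let_def split: artin_gen.splits)

lemma (in group) braid_eval_closed [simp]:
  "\<lbrakk>a \<in> carrier G; b \<in> carrier G\<rbrakk> \<Longrightarrow> braid_eval G a b w \<in> carrier G"
  by (induction w) (auto simp: braid_eval_def)

lemma (in group) braid_eval_append:
  assumes "a \<in> carrier G" "b \<in> carrier G"
  shows "braid_eval G a b (v @ w) = braid_eval G a b v \<otimes> braid_eval G a b w"
proof (induction v)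
  case Nil
  show ?case using braid_eval_closed[OF assms, of w] by (simp add: braid_eval_def)
next
  case (Cons l v)
  have "braid_eval G a b (l # u) = braid_letter G a b l \<otimes> braid_eval G a b u" for u
    by (simp add: braid_eval_def)
  then show ?case using Cons assms by (simp add: m_assoc)
qed

lemma (in group) braid_eval_respects:
  assumes ab: "a \<in> carrier G" "b \<in> carrier G" and rel: "a \<otimes> b \<otimes> a = b \<otimes> a \<otimes> b"
  shows "braid_eq v w \<Longrightarrow> braid_eval G a b v = braid_eval G a b w"
proof (induction rule: braid_eq.induct)
  case (cancel u s e v)
  have "braid_eval G a b [(s, e), (s, \<not> e)] = \<one>"
    using ab by (cases s; cases e) (auto simp: braid_eval_def braid_letter_def)
  then show ?case using ab by (simp add: braid_eval_append del: append_Cons)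
next
  case (braid u v)
  have "braid_eval G a b [(Gen1, True), (Gen2, True), (Gen1, True)] =
        braid_eval G a b [(Gen2, True), (Gen1, True), (Gen2, True)]"
    using ab rel by (simp add: braid_eval_def braid_letter_def m_assoc)
  then show ?case using ab by (simp add: braid_eval_append del: append_Cons)
qed simp_all

lemma B3_universal:
  assumes "group G" and a: "a \<in> carrier G" and b: "b \<in> carrier G"
    and rel: "a \<otimes>\<^bsub>G\<^esub> b \<otimes>\<^bsub>G\<^esub> a = b \<otimes>\<^bsub>G\<^esub> a \<otimes>\<^bsub>G\<^esub> b"
  obtains h where "h \<in> hom B3 G" "h \<sigma>\<^sub>1 = a" "h \<sigma>\<^sub>2 = b"
proof -
  interpret group G by fact
  define h where "h A = braid_eval G a b (SOME w. A = braid_class w)" for A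
  have h: "h (braid_class w) = braid_eval G a b w" for w
  proof -
    have "braid_class w = braid_class (SOME v. braid_class w = braid_class v)"
      by (rule someI[of _ w]) simp
    then have "braid_eq (SOME v. braid_class w = braid_class v) w"
      by (metis braid_class_eq_iff)
    then show ?thesis
      unfolding h_def by (rule braid_eval_respects[OF a b rel])
  qed
  have "h \<in> hom B3 G"
    by (rule homI) (auto simp: B3_def h B3_mult[unfolded B3_def, simplified] braid_eval_append a b)
  moreover have "h \<sigma>\<^sub>1 = a" "h \<sigma>\<^sub>2 = b"
    using a b by (simp_all add: \<sigma>\<^sub>1_def \<sigma>\<^sub>2_def h braid_eval_def braid_letter_def)
  ultimately show thesis using that by blast
qed

text \<open>\<open>\<Delta>\<close> is the half twist; with \<open>\<delta>\<close> it generates \<open>B3\<close> subject to the single relation that \<open>\<Delta>\<^sup>2\<close> and \<open>\<delta>\<^sup>3\<close>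
  agree. This common value \<open>\<zeta>\<close>, the full twist, is central. The presentation exhibits \<open>B3/\<langle>\<zeta>\<rangle>\<close> as a
  free product of cyclic groups of orders 2 and 3.\<close>

definition \<Delta> :: "braid_word set" where "\<Delta> = \<sigma>\<^sub>1 \<otimes>\<^bsub>B3\<^esub> \<sigma>\<^sub>2 \<otimes>\<^bsub>B3\<^esub> \<sigma>\<^sub>1"
definition \<delta> :: "braid_word set" where "\<delta> = \<sigma>\<^sub>1 \<otimes>\<^bsub>B3\<^esub> \<sigma>\<^sub>2"
definition \<zeta> :: "braid_word set" where "\<zeta> = \<Delta> \<otimes>\<^bsub>B3\<^esub> \<Delta>"

interpretation B3: group B3 by (rule group_B3)

lemma artin_closed [simp]: "\<sigma>\<^sub>1 \<in> carrier B3" "\<sigma>\<^sub>2 \<in> carrier B3"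
  by (simp_all add: \<sigma>\<^sub>1_def \<sigma>\<^sub>2_def B3_def)

lemma torus_gens_closed [simp]: "\<Delta> \<in> carrier B3" "\<delta> \<in> carrier B3" "\<zeta> \<in> carrier B3"
  by (simp_all add: \<Delta>_def \<delta>_def \<zeta>_def)

lemma braid_relation: "\<sigma>\<^sub>1 \<otimes>\<^bsub>B3\<^esub> \<sigma>\<^sub>2 \<otimes>\<^bsub>B3\<^esub> \<sigma>\<^sub>1 = \<sigma>\<^sub>2 \<otimes>\<^bsub>B3\<^esub> \<sigma>\<^sub>1 \<otimes>\<^bsub>B3\<^esub> \<sigma>\<^sub>2"
  using braid_eq.braid[of "[]" "[]"] by (simp add: \<sigma>\<^sub>1_def \<sigma>\<^sub>2_def B3_mult braid_class_eq_iff)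

lemma \<Delta>_eq: "\<Delta> = \<delta> \<otimes>\<^bsub>B3\<^esub> \<sigma>\<^sub>1"
  by (simp add: \<Delta>_def \<delta>_def)

lemma \<Delta>_eq': "\<Delta> = \<sigma>\<^sub>2 \<otimes>\<^bsub>B3\<^esub> \<delta>"
  by (simp add: \<Delta>_def \<delta>_def braid_relation B3.m_assoc)

lemma \<zeta>_eq: "\<zeta> = \<delta> \<otimes>\<^bsub>B3\<^esub> \<delta> \<otimes>\<^bsub>B3\<^esub> \<delta>"
proof -
  have "\<zeta> = \<delta> \<otimes>\<^bsub>B3\<^esub> \<sigma>\<^sub>1 \<otimes>\<^bsub>B3\<^esub> (\<sigma>\<^sub>2 \<otimes>\<^bsub>B3\<^esub> \<delta>)"
    unfolding \<zeta>_def by (metis \<Delta>_eq \<Delta>_eq')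
  then show ?thesis
    by (metis \<delta>_def B3.m_assoc B3.m_closed artin_closed)
qed

lemma \<sigma>\<^sub>2_conj: "\<sigma>\<^sub>2 = \<delta> \<otimes>\<^bsub>B3\<^esub> \<sigma>\<^sub>1 \<otimes>\<^bsub>B3\<^esub> inv\<^bsub>B3\<^esub> \<delta>"
  by (metis \<Delta>_eq \<Delta>_eq' B3.inv_solve_right artin_closed torus_gens_closed)

lemma \<zeta>_\<Delta>: "\<zeta> \<otimes>\<^bsub>B3\<^esub> \<Delta> = \<Delta> \<otimes>\<^bsub>B3\<^esub> \<zeta>"
  by (simp add: \<zeta>_def B3.m_assoc)

lemma \<zeta>_\<delta>: "\<zeta> \<otimes>\<^bsub>B3\<^esub> \<delta> = \<delta> \<otimes>\<^bsub>B3\<^esub> \<zeta>"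
  by (simp add: \<zeta>_eq B3.m_assoc)

text \<open>Inverses of \<open>\<Delta>\<close> and \<open>\<delta>\<close> are positive words in \<open>\<Delta>\<close> and \<open>\<delta>\<close> up to powers of \<open>\<zeta>\<close>, so only the inverse of \<open>\<zeta>\<close>
  has to be treated, which is easy since \<open>\<zeta>\<close> is central.\<close>

lemma B3_induct:
  assumes g: "g \<in> carrier B3" and "P \<Delta>" "P \<delta>" "P (inv\<^bsub>B3\<^esub> \<zeta>)"
    and mult: "\<And>x y. \<lbrakk>x \<in> carrier B3; y \<in> carrier B3; P x; P y\<rbrakk> \<Longrightarrow> P (x \<otimes>\<^bsub>B3\<^esub> y)"
  shows "P g"
proof -
  have iD: "inv\<^bsub>B3\<^esub> \<Delta> = inv\<^bsub>B3\<^esub> \<zeta> \<otimes>\<^bsub>B3\<^esub> \<Delta>"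
    by (simp add: \<zeta>_def B3.inv_mult_group B3.m_assoc)
  have id: "inv\<^bsub>B3\<^esub> \<delta> = inv\<^bsub>B3\<^esub> \<zeta> \<otimes>\<^bsub>B3\<^esub> (\<delta> \<otimes>\<^bsub>B3\<^esub> \<delta>)"
  proof -
    have "inv\<^bsub>B3\<^esub> \<zeta> = inv\<^bsub>B3\<^esub> \<delta> \<otimes>\<^bsub>B3\<^esub> inv\<^bsub>B3\<^esub> (\<delta> \<otimes>\<^bsub>B3\<^esub> \<delta>)"
      by (simp add: \<zeta>_eq B3.inv_mult_group B3.m_assoc)
    then show ?thesis by (simp add: B3.m_assoc)
  qed
  have PiD: "P (inv\<^bsub>B3\<^esub> \<Delta>)" and Pid: "P (inv\<^bsub>B3\<^esub> \<delta>)"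
    unfolding iD id using assms by (simp_all add: mult)
  have s1: "\<sigma>\<^sub>1 = inv\<^bsub>B3\<^esub> \<delta> \<otimes>\<^bsub>B3\<^esub> \<Delta>"
    by (simp add: \<Delta>_eq flip: B3.m_assoc)
  have s2: "\<sigma>\<^sub>2 = \<Delta> \<otimes>\<^bsub>B3\<^esub> inv\<^bsub>B3\<^esub> \<delta>"
    by (simp add: \<Delta>_eq' B3.m_assoc)
  have P1: "P \<sigma>\<^sub>1" "P (inv\<^bsub>B3\<^esub> \<sigma>\<^sub>1)" "P \<sigma>\<^sub>2" "P (inv\<^bsub>B3\<^esub> \<sigma>\<^sub>2)"
    unfolding s1 s2 using assms PiD Pid by (simp_all add: mult B3.inv_mult_group)
  have one: "P \<one>\<^bsub>B3\<^esub>"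
    using mult[OF _ _ \<open>P \<Delta>\<close> PiD] by simp
  have inv_letter: "inv\<^bsub>B3\<^esub> (braid_class [(s, True)]) = braid_class [(s, False)]" for s
  proof (rule B3.inv_equality)
    have "braid_eq ([] @ [(s, False), (s, \<not> False)] @ []) ([] @ [])"
      by (rule braid_eq.cancel)
    then show "braid_class [(s, False)] \<otimes>\<^bsub>B3\<^esub> braid_class [(s, True)] = \<one>\<^bsub>B3\<^esub>"
      by (simp add: B3_mult) (simp add: B3_def braid_class_eq_iff)
  qed (simp_all add: B3_def)
  have letter: "P (braid_class [l])" for l
  proof (cases l)
    case (Pair s e)
    then show ?thesis
      using P1 inv_letter[of s] by (cases s; cases e) (simp_all add: \<sigma>\<^sub>1_def \<sigma>\<^sub>2_def)
  qed
  have "P (braid_class w)" for w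
  proof (induction w)
    case Nil
    show ?case using one by (simp add: B3_def)
  next
    case (Cons l w)
    have "braid_class (l # w) = braid_class [l] \<otimes>\<^bsub>B3\<^esub> braid_class w"
      by (simp add: B3_mult)
    then show ?case using Cons letter mult[of "braid_class [l]" "braid_class w"] by (simp add: B3_def)
  qed
  then show ?thesis using g by (auto simp: B3_def)
qed

lemma \<zeta>_central:
  assumes "g \<in> carrier B3" shows "\<zeta> \<otimes>\<^bsub>B3\<^esub> g = g \<otimes>\<^bsub>B3\<^esub> \<zeta>"
  using assms
proof (rule B3_induct)
  fix x y assume "x \<in> carrier B3" "y \<in> carrier B3"
    "\<zeta> \<otimes>\<^bsub>B3\<^esub> x = x \<otimes>\<^bsub>B3\<^esub> \<zeta>" "\<zeta> \<otimes>\<^bsub>B3\<^esub> y = y \<otimes>\<^bsub>B3\<^esub> \<zeta>"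
  then show "\<zeta> \<otimes>\<^bsub>B3\<^esub> (x \<otimes>\<^bsub>B3\<^esub> y) = x \<otimes>\<^bsub>B3\<^esub> y \<otimes>\<^bsub>B3\<^esub> \<zeta>"
    by (metis B3.m_assoc torus_gens_closed(3))
qed (simp_all add: \<zeta>_\<Delta> \<zeta>_\<delta>)

lemma B3_universal_torus:
  assumes "group G" and a: "a \<in> carrier G" and b: "b \<in> carrier G"
    and rel: "a \<otimes>\<^bsub>G\<^esub> a = b \<otimes>\<^bsub>G\<^esub> b \<otimes>\<^bsub>G\<^esub> b"
  obtains h where "h \<in> hom B3 G" "h \<Delta> = a" "h \<delta> = b"
proof -
  interpret G: group G by fact
  let ?s = "inv\<^bsub>G\<^esub> b \<otimes>\<^bsub>G\<^esub> a" and ?t = "a \<otimes>\<^bsub>G\<^esub> inv\<^bsub>G\<^esub> b"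
  have [simp]: "inv\<^bsub>G\<^esub> x \<otimes>\<^bsub>G\<^esub> (x \<otimes>\<^bsub>G\<^esub> y) = y" "x \<otimes>\<^bsub>G\<^esub> (inv\<^bsub>G\<^esub> x \<otimes>\<^bsub>G\<^esub> y) = y" if "x \<in> carrier G" "y \<in> carrier G" for x y
    using that by (simp_all flip: G.m_assoc)
  have st: "?s \<otimes>\<^bsub>G\<^esub> ?t = b"
  proof -
    have "?s \<otimes>\<^bsub>G\<^esub> ?t = inv\<^bsub>G\<^esub> b \<otimes>\<^bsub>G\<^esub> (a \<otimes>\<^bsub>G\<^esub> a) \<otimes>\<^bsub>G\<^esub> inv\<^bsub>G\<^esub> b" using a b by (simp add: G.m_assoc)
    also have "\<dots> = b" using a b by (simp add: rel G.m_assoc)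
    finally show ?thesis .
  qed
  have sts: "?s \<otimes>\<^bsub>G\<^esub> ?t \<otimes>\<^bsub>G\<^esub> ?s = a" "?t \<otimes>\<^bsub>G\<^esub> ?s \<otimes>\<^bsub>G\<^esub> ?t = a"
  proof -
    show "?s \<otimes>\<^bsub>G\<^esub> ?t \<otimes>\<^bsub>G\<^esub> ?s = a" unfolding st using a b by simp
    have "?t \<otimes>\<^bsub>G\<^esub> (?s \<otimes>\<^bsub>G\<^esub> ?t) = a" unfolding st using a b by (simp add: G.m_assoc)
    then show "?t \<otimes>\<^bsub>G\<^esub> ?s \<otimes>\<^bsub>G\<^esub> ?t = a" using a b by (simp add: G.m_assoc)
  qed
  obtain h where h: "h \<in> hom B3 G" "h \<sigma>\<^sub>1 = ?s" "h \<sigma>\<^sub>2 = ?t"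
    by (rule B3_universal[of G ?s ?t]) (use a b sts \<open>group G\<close> in simp_all)
  have "h \<delta> = b"
    using h st by (simp add: \<delta>_def hom_mult)
  moreover have "h \<Delta> = a"
    using h sts by (simp add: \<Delta>_def hom_mult)
  ultimately show thesis using h that by blast
qed

lemma \<zeta>_zpow_central:
  fixes k :: int
  assumes "g \<in> carrier B3"
  shows "\<zeta> [^]\<^bsub>B3\<^esub> k \<otimes>\<^bsub>B3\<^esub> g = g \<otimes>\<^bsub>B3\<^esub> \<zeta> [^]\<^bsub>B3\<^esub> k"
proof -
  have "subgroup {z \<in> carrier B3. z \<otimes>\<^bsub>B3\<^esub> g = g \<otimes>\<^bsub>B3\<^esub> z} B3"
  proof (rule B3.subgroupI)
    fix a assume "a \<in> {z \<in> carrier B3. z \<otimes>\<^bsub>B3\<^esub> g = g \<otimes>\<^bsub>B3\<^esub> z}"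
    then have a: "a \<in> carrier B3" "a \<otimes>\<^bsub>B3\<^esub> g = g \<otimes>\<^bsub>B3\<^esub> a" by auto
    have "inv\<^bsub>B3\<^esub> a \<otimes>\<^bsub>B3\<^esub> g = g \<otimes>\<^bsub>B3\<^esub> inv\<^bsub>B3\<^esub> a"
      by (metis a assms B3.inv_closed B3.inv_solve_left B3.inv_solve_right B3.m_assoc B3.m_closed)
    then show "inv\<^bsub>B3\<^esub> a \<in> {z \<in> carrier B3. z \<otimes>\<^bsub>B3\<^esub> g = g \<otimes>\<^bsub>B3\<^esub> z}" using a by simp
  next
    fix a b assume "a \<in> {z \<in> carrier B3. z \<otimes>\<^bsub>B3\<^esub> g = g \<otimes>\<^bsub>B3\<^esub> z}"
      "b \<in> {z \<in> carrier B3. z \<otimes>\<^bsub>B3\<^esub> g = g \<otimes>\<^bsub>B3\<^esub> z}"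
    then show "a \<otimes>\<^bsub>B3\<^esub> b \<in> {z \<in> carrier B3. z \<otimes>\<^bsub>B3\<^esub> g = g \<otimes>\<^bsub>B3\<^esub> z}"
      using assms by simp (metis B3.m_assoc)
  qed (use assms in auto)
  then have "\<zeta> [^]\<^bsub>B3\<^esub> k \<in> {z \<in> carrier B3. z \<otimes>\<^bsub>B3\<^esub> g = g \<otimes>\<^bsub>B3\<^esub> z}"
    by (rule B3.subgroup_int_pow_closed) (simp add: \<zeta>_central[OF assms])
  then show ?thesis by simp
qed

section \<open>Subgroups of the braid group normally generated by a generator\<close>

text \<open>The powers of \<open>\<zeta>\<close> make up the centre of \<open>B3\<close>, whence the name.\<close>

definition modulo_centre :: "braid_word set set \<Rightarrow> braid_word set set" where
  "modulo_centre H = {g \<in> carrier B3. \<exists>k::int. g \<otimes>\<^bsub>B3\<^esub> \<zeta> [^]\<^bsub>B3\<^esub> k \<in> H}"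

lemma subgroup_modulo_centre:
  assumes H: "subgroup H B3"
  shows "subgroup (modulo_centre H) B3"
proof (rule B3.subgroupI)
  have one: "\<one>\<^bsub>B3\<^esub> \<in> modulo_centre H"
    using subgroup.one_closed[OF H] unfolding modulo_centre_def
    by (auto intro!: exI[of _ 0])
  then show "modulo_centre H \<noteq> {}" by blast
  fix a assume "a \<in> modulo_centre H"
  then obtain k :: int where a: "a \<in> carrier B3" "a \<otimes>\<^bsub>B3\<^esub> \<zeta> [^]\<^bsub>B3\<^esub> k \<in> H"
    by (auto simp: modulo_centre_def)
  have "inv\<^bsub>B3\<^esub> (a \<otimes>\<^bsub>B3\<^esub> \<zeta> [^]\<^bsub>B3\<^esub> k) = \<zeta> [^]\<^bsub>B3\<^esub> (- k) \<otimes>\<^bsub>B3\<^esub> inv\<^bsub>B3\<^esub> a"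
    using a by (simp add: B3.inv_mult_group B3.int_pow_neg)
  also have "\<dots> = inv\<^bsub>B3\<^esub> a \<otimes>\<^bsub>B3\<^esub> \<zeta> [^]\<^bsub>B3\<^esub> (- k)"
    using a by (simp only: \<zeta>_zpow_central B3.inv_closed)
  finally have "inv\<^bsub>B3\<^esub> a \<otimes>\<^bsub>B3\<^esub> \<zeta> [^]\<^bsub>B3\<^esub> (- k) \<in> H"
    using subgroup.m_inv_closed[OF H a(2)] by simp
  then show "inv\<^bsub>B3\<^esub> a \<in> modulo_centre H" unfolding modulo_centre_def using a(1) by blast
  fix b assume "b \<in> modulo_centre H"
  then obtain l :: int where b: "b \<in> carrier B3" "b \<otimes>\<^bsub>B3\<^esub> \<zeta> [^]\<^bsub>B3\<^esub> l \<in> H"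
    by (auto simp: modulo_centre_def)
  have "(a \<otimes>\<^bsub>B3\<^esub> \<zeta> [^]\<^bsub>B3\<^esub> k) \<otimes>\<^bsub>B3\<^esub> (b \<otimes>\<^bsub>B3\<^esub> \<zeta> [^]\<^bsub>B3\<^esub> l)
      = a \<otimes>\<^bsub>B3\<^esub> (\<zeta> [^]\<^bsub>B3\<^esub> k \<otimes>\<^bsub>B3\<^esub> b) \<otimes>\<^bsub>B3\<^esub> \<zeta> [^]\<^bsub>B3\<^esub> l"
    using a b by (simp add: B3.m_assoc)
  also have "\<dots> = a \<otimes>\<^bsub>B3\<^esub> b \<otimes>\<^bsub>B3\<^esub> \<zeta> [^]\<^bsub>B3\<^esub> (k + l)"
    unfolding \<zeta>_zpow_central[OF b(1)] using a b by (simp add: B3.m_assoc B3.int_pow_mult)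
  finally have "a \<otimes>\<^bsub>B3\<^esub> b \<otimes>\<^bsub>B3\<^esub> \<zeta> [^]\<^bsub>B3\<^esub> (k + l) \<in> H"
    using subgroup.m_closed[OF H a(2) b(2)] by simp
  then show "a \<otimes>\<^bsub>B3\<^esub> b \<in> modulo_centre H" unfolding modulo_centre_def using a(1) b(1) by blast
qed (auto simp: modulo_centre_def)

lemma subset_modulo_centre: "subgroup H B3 \<Longrightarrow> H \<subseteq> modulo_centre H"
  unfolding modulo_centre_def
  by (auto intro!: exI[of _ 0] dest: subgroup.mem_carrier)

lemma \<zeta>_in_modulo_centre:
  assumes "subgroup H B3" shows "\<zeta> \<in> modulo_centre H"
  unfolding modulo_centre_def
  using subgroup.one_closed[OF assms]
  by (auto intro!: exI[of _ "-1"] simp: B3.int_pow_neg)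

text \<open>A central factor does not matter for conjugation: if \<open>\<delta>\<zeta>\<^sup>k\<close> is in \<open>H\<close>, it conjugates \<open>\<sigma>\<^sub>1\<close> to \<open>\<sigma>\<^sub>2\<close>.\<close>

lemma subgroup_eq_B3I:
  assumes H: "subgroup H B3" and s: "\<sigma>\<^sub>1 \<in> H" and d: "\<delta> \<in> modulo_centre H"
  shows "H = carrier B3"
proof -
  obtain k :: int where k: "\<delta> \<otimes>\<^bsub>B3\<^esub> \<zeta> [^]\<^bsub>B3\<^esub> k \<in> H" using d by (auto simp: modulo_centre_def)
  let ?z = "\<zeta> [^]\<^bsub>B3\<^esub> k" and ?x = "\<delta> \<otimes>\<^bsub>B3\<^esub> \<zeta> [^]\<^bsub>B3\<^esub> k"
  have "?x \<otimes>\<^bsub>B3\<^esub> \<sigma>\<^sub>1 \<otimes>\<^bsub>B3\<^esub> inv\<^bsub>B3\<^esub> ?x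
     = \<delta> \<otimes>\<^bsub>B3\<^esub> (?z \<otimes>\<^bsub>B3\<^esub> \<sigma>\<^sub>1) \<otimes>\<^bsub>B3\<^esub> inv\<^bsub>B3\<^esub> ?x"
    by (simp add: B3.m_assoc)
  also have "\<dots> = \<sigma>\<^sub>2"
    unfolding \<zeta>_zpow_central[OF artin_closed(1)]
    by (simp add: B3.m_assoc B3.inv_mult_group \<sigma>\<^sub>2_conj) (simp flip: B3.m_assoc)
  finally have s2: "\<sigma>\<^sub>2 \<in> H"
    using H k s by (metis subgroup.m_closed subgroup.m_inv_closed)
  note cl = subgroup.m_closed[OF H] subgroup.m_inv_closed[OF H]
  have "\<Delta> \<in> H" "\<delta> \<in> H" using s s2 cl by (simp_all add: \<Delta>_def \<delta>_def)
  moreover have "inv\<^bsub>B3\<^esub> \<zeta> \<in> H" using \<open>\<Delta> \<in> H\<close> cl by (simp add: \<zeta>_def)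
  ultimately have "g \<in> H" if "g \<in> carrier B3" for g
    using that by (rule_tac P = "\<lambda>g. g \<in> H" in B3_induct) (auto intro: cl)
  then show ?thesis using subgroup.subset[OF H] by blast
qed

text \<open>Let the subgroup \<open>M\<close> contain \<open>\<sigma>\<^sub>1\<close> and \<open>\<zeta>\<close> but not \<open>\<delta>\<close>. As \<open>\<Delta> = \<delta>\<sigma>\<^sub>1\<close>, multiplication
  by \<open>\<Delta>\<close> exchanges the cosets \<open>M\<close> and \<open>\<delta>M\<close>. The twisted
  version does so without the factor \<open>\<sigma>\<^sub>1\<close>: it sends \<open>g\<close> in \<open>M\<close> to \<open>\<delta>g\<close>, and \<open>\<delta>g\<close> back to \<open>\<zeta>g\<close>. Its square is
  still multiplication by \<open>\<zeta>\<close>, so together with multiplication by \<open>\<delta>\<close> it defines an action of \<open>B3\<close>, in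
  which \<open>\<sigma>\<^sub>1\<close> fixes the unit element.\<close>

definition twisted_half_twist :: "braid_word set set \<Rightarrow> braid_word set \<Rightarrow> braid_word set" where
  "twisted_half_twist M g =
     (if g \<in> M then \<delta> \<otimes>\<^bsub>B3\<^esub> g
      else if inv\<^bsub>B3\<^esub> \<delta> \<otimes>\<^bsub>B3\<^esub> g \<in> M then \<zeta> \<otimes>\<^bsub>B3\<^esub> (inv\<^bsub>B3\<^esub> \<delta> \<otimes>\<^bsub>B3\<^esub> g)
      else \<Delta> \<otimes>\<^bsub>B3\<^esub> g)"

lemma B3_cancel [simp]:
  assumes "x \<in> carrier B3" "y \<in> carrier B3"
  shows "inv\<^bsub>B3\<^esub> x \<otimes>\<^bsub>B3\<^esub> (x \<otimes>\<^bsub>B3\<^esub> y) = y" "x \<otimes>\<^bsub>B3\<^esub> (inv\<^bsub>B3\<^esub> x \<otimes>\<^bsub>B3\<^esub> y) = y"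
  using assms by (simp_all flip: B3.m_assoc)

locale twisting_subgroup =
  fixes M :: "braid_word set set"
  assumes M: "subgroup M B3" and s1: "\<sigma>\<^sub>1 \<in> M" and z: "\<zeta> \<in> M" and d: "\<delta> \<notin> M"
begin

lemma mem_carrier_B3 [simp]: "x \<in> M \<Longrightarrow> x \<in> carrier B3"
  using subgroup.mem_carrier[OF M] .

lemma mult_mem_iff [simp]:
  assumes "x \<in> M" "g \<in> carrier B3" shows "x \<otimes>\<^bsub>B3\<^esub> g \<in> M \<longleftrightarrow> g \<in> M"
  using assms by (metis B3_cancel(1) M mem_carrier_B3 subgroup.m_closed subgroup.m_inv_closed)

lemma mult_mem_iff' [simp]:
  assumes "x \<in> M" "g \<in> carrier B3" shows "g \<otimes>\<^bsub>B3\<^esub> x \<in> M \<longleftrightarrow> g \<in> M"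
  using assms by (metis B3.inv_solve_right' M mem_carrier_B3 subgroup.m_closed subgroup.m_inv_closed)

lemma \<Delta>_mult_\<delta>: "\<Delta> \<otimes>\<^bsub>B3\<^esub> \<delta> = \<zeta> \<otimes>\<^bsub>B3\<^esub> inv\<^bsub>B3\<^esub> \<sigma>\<^sub>1"
proof -
  have "\<delta> = \<Delta> \<otimes>\<^bsub>B3\<^esub> inv\<^bsub>B3\<^esub> \<sigma>\<^sub>1" by (simp add: \<Delta>_eq B3.m_assoc)
  then show ?thesis by (simp add: \<zeta>_def B3.m_assoc)
qed

lemma \<Delta>_mem_iff:
  assumes g: "g \<in> carrier B3" shows "\<Delta> \<otimes>\<^bsub>B3\<^esub> g \<in> M \<longleftrightarrow> inv\<^bsub>B3\<^esub> \<delta> \<otimes>\<^bsub>B3\<^esub> g \<in> M"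
proof -
  have "\<Delta> \<otimes>\<^bsub>B3\<^esub> g = \<Delta> \<otimes>\<^bsub>B3\<^esub> \<delta> \<otimes>\<^bsub>B3\<^esub> (inv\<^bsub>B3\<^esub> \<delta> \<otimes>\<^bsub>B3\<^esub> g)"
    using g by (simp add: B3.m_assoc)
  moreover have "\<Delta> \<otimes>\<^bsub>B3\<^esub> \<delta> \<in> M"
    unfolding \<Delta>_mult_\<delta> using M s1 z by (meson subgroup.m_closed subgroup.m_inv_closed)
  ultimately show ?thesis using g by simp
qed

lemma inv_\<delta>_\<Delta>_mem_iff:
  assumes g: "g \<in> carrier B3"
  shows "inv\<^bsub>B3\<^esub> \<delta> \<otimes>\<^bsub>B3\<^esub> (\<Delta> \<otimes>\<^bsub>B3\<^esub> g) \<in> M \<longleftrightarrow> g \<in> M"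
  using g s1 by (simp add: \<Delta>_eq B3.m_assoc)

lemma \<delta>_mult_notin: "g \<in> M \<Longrightarrow> \<delta> \<otimes>\<^bsub>B3\<^esub> g \<notin> M"
  using d by simp

abbreviation "t \<equiv> twisted_half_twist M"

lemma t_closed [simp]: "g \<in> carrier B3 \<Longrightarrow> t g \<in> carrier B3"
  by (simp add: twisted_half_twist_def)

lemma t_squared: "g \<in> carrier B3 \<Longrightarrow> t (t g) = \<zeta> \<otimes>\<^bsub>B3\<^esub> g"
proof -
  assume g: "g \<in> carrier B3"
  consider "g \<in> M" | "g \<notin> M" "inv\<^bsub>B3\<^esub> \<delta> \<otimes>\<^bsub>B3\<^esub> g \<in> M" | "g \<notin> M" "inv\<^bsub>B3\<^esub> \<delta> \<otimes>\<^bsub>B3\<^esub> g \<notin> M"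
    by blast
  then show ?thesis
  proof cases
    case 1
    then show ?thesis using g \<delta>_mult_notin by (simp add: twisted_half_twist_def)
  next
    case 2
    have "\<zeta> \<otimes>\<^bsub>B3\<^esub> (inv\<^bsub>B3\<^esub> \<delta> \<otimes>\<^bsub>B3\<^esub> g) \<in> M" using 2 g z by simp
    moreover have "\<delta> \<otimes>\<^bsub>B3\<^esub> (\<zeta> \<otimes>\<^bsub>B3\<^esub> (inv\<^bsub>B3\<^esub> \<delta> \<otimes>\<^bsub>B3\<^esub> g)) = \<zeta> \<otimes>\<^bsub>B3\<^esub> g"
      using g by (metis B3.inv_closed B3.m_assoc B3.m_closed B3_cancel(2) \<zeta>_\<delta> torus_gens_closed(2,3))
    ultimately show ?thesis using 2 by (simp add: twisted_half_twist_def)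
  next
    case 3
    then have "\<Delta> \<otimes>\<^bsub>B3\<^esub> g \<notin> M" "inv\<^bsub>B3\<^esub> \<delta> \<otimes>\<^bsub>B3\<^esub> (\<Delta> \<otimes>\<^bsub>B3\<^esub> g) \<notin> M"
      using g \<Delta>_mem_iff inv_\<delta>_\<Delta>_mem_iff by auto
    then show ?thesis using 3 g by (simp add: twisted_half_twist_def \<zeta>_def B3.m_assoc)
  qed
qed

lemma t_equivariant: "\<lbrakk>g \<in> carrier B3; m \<in> M\<rbrakk> \<Longrightarrow> t (g \<otimes>\<^bsub>B3\<^esub> m) = t g \<otimes>\<^bsub>B3\<^esub> m"
  by (simp add: twisted_half_twist_def flip: B3.m_assoc)

lemma t_coset:
  assumes g: "g \<in> carrier B3"
  shows "inv\<^bsub>B3\<^esub> (\<Delta> \<otimes>\<^bsub>B3\<^esub> g) \<otimes>\<^bsub>B3\<^esub> t g \<in> M"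
proof -
  consider "g \<in> M" | "g \<notin> M" "inv\<^bsub>B3\<^esub> \<delta> \<otimes>\<^bsub>B3\<^esub> g \<in> M" | "g \<notin> M" "inv\<^bsub>B3\<^esub> \<delta> \<otimes>\<^bsub>B3\<^esub> g \<notin> M"
    by blast
  then show ?thesis
  proof cases
    case 1
    have "inv\<^bsub>B3\<^esub> (\<Delta> \<otimes>\<^bsub>B3\<^esub> g) \<otimes>\<^bsub>B3\<^esub> t g = inv\<^bsub>B3\<^esub> g \<otimes>\<^bsub>B3\<^esub> (inv\<^bsub>B3\<^esub> \<sigma>\<^sub>1 \<otimes>\<^bsub>B3\<^esub> g)"
      using 1 by (simp add: twisted_half_twist_def \<Delta>_eq B3.inv_mult_group B3.m_assoc)
    then show ?thesis using 1 s1 M by (metis subgroup.m_closed subgroup.m_inv_closed)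
  next
    case 2
    have "\<Delta> \<otimes>\<^bsub>B3\<^esub> g \<in> M" using 2 g \<Delta>_mem_iff by simp
    moreover have "t g \<in> M" using 2 g z by (simp add: twisted_half_twist_def)
    ultimately show ?thesis using M by (metis subgroup.m_closed subgroup.m_inv_closed)
  next
    case 3
    then show ?thesis using g M by (simp add: twisted_half_twist_def subgroup.one_closed)
  qed
qed

lemma t_Bij: "restrict t (carrier B3) \<in> Bij (carrier B3)"
proof -
  have "inj_on t (carrier B3)"
  proof (rule inj_onI)
    fix x y assume xy: "x \<in> carrier B3" "y \<in> carrier B3" and "t x = t y"
    then have "t (t x) = t (t y)" by simp
    then show "x = y" using xy by (simp add: t_squared)
  qed
  moreover have "t ` carrier B3 = carrier B3"
  proof
    show "carrier B3 \<subseteq> t ` carrier B3"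
    proof
      fix g assume g: "g \<in> carrier B3"
      show "g \<in> t ` carrier B3"
        by (rule image_eqI[of _ _ "t (inv\<^bsub>B3\<^esub> \<zeta> \<otimes>\<^bsub>B3\<^esub> g)"]) (use g t_squared in simp_all)
    qed
  qed auto
  ultimately show ?thesis
    unfolding Bij_def by (simp add: bij_betw_def inj_on_restrict_eq)
qed

lemma \<delta>_Bij: "restrict (\<lambda>g. \<delta> \<otimes>\<^bsub>B3\<^esub> g) (carrier B3) \<in> Bij (carrier B3)"
proof -
  have "(\<lambda>g. \<delta> \<otimes>\<^bsub>B3\<^esub> g) ` carrier B3 = carrier B3"
  proof
    show "carrier B3 \<subseteq> (\<lambda>g. \<delta> \<otimes>\<^bsub>B3\<^esub> g) ` carrier B3"
    proof
      fix g assume g: "g \<in> carrier B3"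
      show "g \<in> (\<lambda>g. \<delta> \<otimes>\<^bsub>B3\<^esub> g) ` carrier B3"
        by (rule image_eqI[of _ _ "inv\<^bsub>B3\<^esub> \<delta> \<otimes>\<^bsub>B3\<^esub> g"]) (use g in simp_all)
    qed
  qed auto
  then show ?thesis
    unfolding Bij_def by (simp add: bij_betw_def inj_on_def)
qed

lemma twisted_action:
  obtains \<alpha> :: "braid_word set \<Rightarrow> braid_word set \<Rightarrow> braid_word set" where
    "\<And>w g. \<lbrakk>w \<in> carrier B3; g \<in> carrier B3\<rbrakk> \<Longrightarrow> \<alpha> w g \<in> carrier B3"
    "\<And>v w g. \<lbrakk>v \<in> carrier B3; w \<in> carrier B3; g \<in> carrier B3\<rbrakk> \<Longrightarrow> \<alpha> (v \<otimes>\<^bsub>B3\<^esub> w) g = \<alpha> v (\<alpha> w g)"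
    "\<And>g. g \<in> carrier B3 \<Longrightarrow> \<alpha> \<one>\<^bsub>B3\<^esub> g = g"
    "\<And>g. g \<in> carrier B3 \<Longrightarrow> \<alpha> \<Delta> g = t g"
    "\<And>g. g \<in> carrier B3 \<Longrightarrow> \<alpha> \<delta> g = \<delta> \<otimes>\<^bsub>B3\<^esub> g"
proof -
  let ?S = "carrier B3" let ?G = "BijGroup ?S"
  let ?a = "restrict t ?S" and ?b = "restrict (\<lambda>g. \<delta> \<otimes>\<^bsub>B3\<^esub> g) ?S"
  have car: "carrier ?G = Bij ?S" by (simp add: BijGroup_def)
  have mult: "x \<otimes>\<^bsub>?G\<^esub> y = compose ?S x y" if "x \<in> Bij ?S" "y \<in> Bij ?S" for x y
    using that by (simp add: BijGroup_def)
  have rel: "?a \<otimes>\<^bsub>?G\<^esub> ?a = ?b \<otimes>\<^bsub>?G\<^esub> ?b \<otimes>\<^bsub>?G\<^esub> ?b"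
    unfolding mult[OF t_Bij t_Bij] mult[OF \<delta>_Bij \<delta>_Bij] mult[OF compose_Bij[OF \<delta>_Bij \<delta>_Bij] \<delta>_Bij]
    by (rule ext) (simp add: compose_def t_squared, simp add: \<zeta>_eq B3.m_assoc)
  obtain \<alpha> where \<alpha>: "\<alpha> \<in> hom B3 ?G" "\<alpha> \<Delta> = ?a" "\<alpha> \<delta> = ?b"
    by (rule B3_universal_torus[OF group_BijGroup _ _ rel]) (use t_Bij \<delta>_Bij car in auto)
  have Bij: "\<alpha> w \<in> Bij ?S" if "w \<in> ?S" for w
    using \<alpha>(1) that car by (auto simp: hom_def)
  show thesis
  proof (rule that[of \<alpha>])
    show "\<alpha> w g \<in> ?S" if "w \<in> ?S" "g \<in> ?S" for w g
      using Bij_imp_funcset[OF Bij] that by blast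
    show "\<alpha> (v \<otimes>\<^bsub>B3\<^esub> w) g = \<alpha> v (\<alpha> w g)" if "v \<in> ?S" "w \<in> ?S" "g \<in> ?S" for v w g
      using \<alpha>(1) that Bij by (simp add: hom_mult mult compose_def)
    show "\<alpha> \<one>\<^bsub>B3\<^esub> g = g" if "g \<in> ?S" for g
      using hom_one[OF \<alpha>(1) group_B3 group_BijGroup] that by (simp add: BijGroup_def)
  qed (use \<alpha> in auto)
qed

text \<open>The twisted action commutes with right multiplication by \<open>M\<close> and permutes the left cosets of \<open>M\<close> as
  before. So \<open>h m\<close>, the result of \<open>m\<close> acting on the unit element, is an element of \<open>M\<close>, and \<open>h\<close> is a
  homomorphism; it deletes the passages through the step from \<open>M\<close> to \<open>\<delta>M\<close>. If nothing but powers of \<open>\<zeta>\<close> is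
  left after the deletion, then \<open>M\<close> consists of such passages and centralizes \<open>\<sigma>\<^sub>1\<close>. This is the last
  conclusion.\<close>

lemma twisted_action_hom:
  obtains h where "h \<in> hom (B3\<lparr>carrier := M\<rparr>) B3" "h \<sigma>\<^sub>1 = \<one>\<^bsub>B3\<^esub>" "h \<zeta> = \<zeta>"
    "(\<forall>m\<in>M. \<exists>k::int. h m = \<zeta> [^]\<^bsub>B3\<^esub> k) \<longrightarrow> (\<forall>m\<in>M. \<sigma>\<^sub>1 \<otimes>\<^bsub>B3\<^esub> m = m \<otimes>\<^bsub>B3\<^esub> \<sigma>\<^sub>1)"
proof -
  obtain \<alpha> :: "braid_word set \<Rightarrow> braid_word set \<Rightarrow> braid_word set" where
    cl [simp]: "\<And>w g. \<lbrakk>w \<in> carrier B3; g \<in> carrier B3\<rbrakk> \<Longrightarrow> \<alpha> w g \<in> carrier B3" and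
    mu: "\<And>v w g. \<lbrakk>v \<in> carrier B3; w \<in> carrier B3; g \<in> carrier B3\<rbrakk> \<Longrightarrow> \<alpha> (v \<otimes>\<^bsub>B3\<^esub> w) g = \<alpha> v (\<alpha> w g)" and
    un: "\<And>g. g \<in> carrier B3 \<Longrightarrow> \<alpha> \<one>\<^bsub>B3\<^esub> g = g" and
    D: "\<And>g. g \<in> carrier B3 \<Longrightarrow> \<alpha> \<Delta> g = t g" and
    dd: "\<And>g. g \<in> carrier B3 \<Longrightarrow> \<alpha> \<delta> g = \<delta> \<otimes>\<^bsub>B3\<^esub> g"
    using twisted_action by blast
  have Z: "\<alpha> \<zeta> g = \<zeta> \<otimes>\<^bsub>B3\<^esub> g" if "g \<in> carrier B3" for g
    unfolding \<zeta>_def using that by (simp add: mu D t_squared) (simp add: \<zeta>_def)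
  have iZ: "\<alpha> (inv\<^bsub>B3\<^esub> \<zeta>) g = inv\<^bsub>B3\<^esub> \<zeta> \<otimes>\<^bsub>B3\<^esub> g" if g: "g \<in> carrier B3" for g
  proof -
    have "\<zeta> \<otimes>\<^bsub>B3\<^esub> \<alpha> (inv\<^bsub>B3\<^esub> \<zeta>) g = \<alpha> (\<zeta> \<otimes>\<^bsub>B3\<^esub> inv\<^bsub>B3\<^esub> \<zeta>) g"
      using g by (subst mu) (simp_all add: Z)
    then have "\<zeta> \<otimes>\<^bsub>B3\<^esub> \<alpha> (inv\<^bsub>B3\<^esub> \<zeta>) g = g" using g un by simp
    then show ?thesis using g by (metis B3_cancel(1) B3.inv_closed cl torus_gens_closed(3))
  qed
  have equi: "\<forall>g\<in>carrier B3. \<forall>m\<in>M. \<alpha> w (g \<otimes>\<^bsub>B3\<^esub> m) = \<alpha> w g \<otimes>\<^bsub>B3\<^esub> m" if "w \<in> carrier B3" for w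
    using that by (rule B3_induct) (auto simp: D dd iZ t_equivariant B3.m_assoc mu)
  have coset: "\<forall>g\<in>carrier B3. inv\<^bsub>B3\<^esub> (w \<otimes>\<^bsub>B3\<^esub> g) \<otimes>\<^bsub>B3\<^esub> \<alpha> w g \<in> M" if "w \<in> carrier B3" for w
    using that
  proof (rule B3_induct)
    fix x y assume xy: "x \<in> carrier B3" "y \<in> carrier B3"
      and IH: "\<forall>g\<in>carrier B3. inv\<^bsub>B3\<^esub> (x \<otimes>\<^bsub>B3\<^esub> g) \<otimes>\<^bsub>B3\<^esub> \<alpha> x g \<in> M"
        "\<forall>g\<in>carrier B3. inv\<^bsub>B3\<^esub> (y \<otimes>\<^bsub>B3\<^esub> g) \<otimes>\<^bsub>B3\<^esub> \<alpha> y g \<in> M"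
    show "\<forall>g\<in>carrier B3. inv\<^bsub>B3\<^esub> (x \<otimes>\<^bsub>B3\<^esub> y \<otimes>\<^bsub>B3\<^esub> g) \<otimes>\<^bsub>B3\<^esub> \<alpha> (x \<otimes>\<^bsub>B3\<^esub> y) g \<in> M"
    proof
      fix g assume g: "g \<in> carrier B3"
      define m where "m = inv\<^bsub>B3\<^esub> (y \<otimes>\<^bsub>B3\<^esub> g) \<otimes>\<^bsub>B3\<^esub> \<alpha> y g"
      have m: "m \<in> M" "\<alpha> y g = y \<otimes>\<^bsub>B3\<^esub> g \<otimes>\<^bsub>B3\<^esub> m"
        using IH(2) g xy unfolding m_def by (auto simp del: B3.inv_mult_group)
      have "\<alpha> (x \<otimes>\<^bsub>B3\<^esub> y) g = \<alpha> x (y \<otimes>\<^bsub>B3\<^esub> g) \<otimes>\<^bsub>B3\<^esub> m"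
        using xy g m equi by (simp add: mu)
      then have "inv\<^bsub>B3\<^esub> (x \<otimes>\<^bsub>B3\<^esub> y \<otimes>\<^bsub>B3\<^esub> g) \<otimes>\<^bsub>B3\<^esub> \<alpha> (x \<otimes>\<^bsub>B3\<^esub> y) g
         = (inv\<^bsub>B3\<^esub> (x \<otimes>\<^bsub>B3\<^esub> (y \<otimes>\<^bsub>B3\<^esub> g)) \<otimes>\<^bsub>B3\<^esub> \<alpha> x (y \<otimes>\<^bsub>B3\<^esub> g)) \<otimes>\<^bsub>B3\<^esub> m"
        using xy g m by (simp add: B3.m_assoc)
      then show "inv\<^bsub>B3\<^esub> (x \<otimes>\<^bsub>B3\<^esub> y \<otimes>\<^bsub>B3\<^esub> g) \<otimes>\<^bsub>B3\<^esub> \<alpha> (x \<otimes>\<^bsub>B3\<^esub> y) g \<in> M"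
        using IH(1) m(1) M xy g by (metis B3.m_closed subgroup.m_closed)
    qed
  qed (use M in \<open>auto simp: D dd iZ t_coset subgroup.one_closed\<close>)
  define h where "h w = \<alpha> w \<one>\<^bsub>B3\<^esub>" for w
  have hM: "h w \<in> M" if "w \<in> M" for w
    using coset[of w] that M unfolding h_def
    by (metis B3.one_closed B3.r_one cl mem_carrier_B3 mult_mem_iff subgroup.m_inv_closed)
  have "h \<in> hom (B3\<lparr>carrier := M\<rparr>) B3"
  proof (rule homI)
    fix x y assume "x \<in> carrier (B3\<lparr>carrier := M\<rparr>)" "y \<in> carrier (B3\<lparr>carrier := M\<rparr>)"
    then have xy: "x \<in> M" "y \<in> M" by auto
    have "h (x \<otimes>\<^bsub>B3\<^esub> y) = \<alpha> x (\<one>\<^bsub>B3\<^esub> \<otimes>\<^bsub>B3\<^esub> h y)" using xy hM by (simp add: mu h_def)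
    also have "\<dots> = h x \<otimes>\<^bsub>B3\<^esub> h y"
      using equi[of x, rule_format, of "\<one>\<^bsub>B3\<^esub>" "h y"] xy hM
      by (simp add: h_def[of x] del: B3.l_one)
    finally show "h (x \<otimes>\<^bsub>B3\<lparr>carrier := M\<rparr>\<^esub> y) = h x \<otimes>\<^bsub>B3\<^esub> h y" by simp
  qed (use hM in auto)
  moreover have "h \<sigma>\<^sub>1 = \<one>\<^bsub>B3\<^esub>"
  proof -
    have "t \<one>\<^bsub>B3\<^esub> = \<alpha> (\<delta> \<otimes>\<^bsub>B3\<^esub> \<sigma>\<^sub>1) \<one>\<^bsub>B3\<^esub>" by (simp flip: D \<Delta>_eq)
    then have "\<delta> \<otimes>\<^bsub>B3\<^esub> h \<sigma>\<^sub>1 = t \<one>\<^bsub>B3\<^esub>" by (simp add: h_def mu dd)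
    also have "\<dots> = \<delta>" using M by (simp add: twisted_half_twist_def subgroup.one_closed)
    finally show ?thesis by (simp add: h_def B3.r_cancel_one')
  qed
  moreover have "h \<zeta> = \<zeta>" by (simp add: h_def Z)
  moreover have "\<sigma>\<^sub>1 \<otimes>\<^bsub>B3\<^esub> m = m \<otimes>\<^bsub>B3\<^esub> \<sigma>\<^sub>1"
    if hz: "\<forall>m\<in>M. \<exists>k::int. h m = \<zeta> [^]\<^bsub>B3\<^esub> k" and "m \<in> M" for m
  proof -
    define P where "P = {g \<in> carrier B3. \<sigma>\<^sub>1 \<otimes>\<^bsub>B3\<^esub> g = g \<otimes>\<^bsub>B3\<^esub> \<sigma>\<^sub>1}"
    have P: "subgroup P B3"
    proof (rule B3.subgroupI)
      fix a assume "a \<in> P"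
      then have a: "a \<in> carrier B3" "\<sigma>\<^sub>1 \<otimes>\<^bsub>B3\<^esub> a = a \<otimes>\<^bsub>B3\<^esub> \<sigma>\<^sub>1" by (auto simp: P_def)
      have "\<sigma>\<^sub>1 \<otimes>\<^bsub>B3\<^esub> inv\<^bsub>B3\<^esub> a = inv\<^bsub>B3\<^esub> a \<otimes>\<^bsub>B3\<^esub> \<sigma>\<^sub>1"
        by (metis a artin_closed(1) B3.inv_closed B3.inv_solve_left B3.inv_solve_right B3.m_assoc B3.m_closed)
      then show "inv\<^bsub>B3\<^esub> a \<in> P" using a by (simp add: P_def)
    next
      fix a b assume "a \<in> P" "b \<in> P"
      then show "a \<otimes>\<^bsub>B3\<^esub> b \<in> P" by (simp add: P_def) (metis B3.m_assoc artin_closed(1))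
    qed (auto simp: P_def)
    note Pcl = subgroup.m_closed[OF P] subgroup.m_inv_closed[OF P]
    have P1: "\<sigma>\<^sub>1 \<in> P" and Pz: "\<And>k::int. \<zeta> [^]\<^bsub>B3\<^esub> k \<in> P" and Pc: "\<And>g. g \<in> P \<Longrightarrow> g \<in> carrier B3"
      by (simp_all add: P_def \<zeta>_zpow_central)
    \<comment> \<open>What w makes of the unit element differs from w by a right factor in P, which is shown
      by building w up from the left; only the step by the half twist in M and in its translate needs
      that h has central values, to move the deleted factor to the right.\<close>
    define R where "R w \<longleftrightarrow> inv\<^bsub>B3\<^esub> (h w) \<otimes>\<^bsub>B3\<^esub> w \<in> P" for w
    have hc [simp]: "h w \<in> carrier B3" if "w \<in> carrier B3" for w using that by (simp add: h_def)
    have hin: "h w \<in> M \<longleftrightarrow> w \<in> M" if w: "w \<in> carrier B3" for w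
    proof -
      have "inv\<^bsub>B3\<^esub> w \<otimes>\<^bsub>B3\<^esub> h w \<in> M" using coset[OF w, rule_format, of "\<one>\<^bsub>B3\<^esub>"] w by (simp add: h_def)
      then show ?thesis using mult_mem_iff'[of "inv\<^bsub>B3\<^esub> w \<otimes>\<^bsub>B3\<^esub> h w" w] w by simp
    qed
    have hdin: "inv\<^bsub>B3\<^esub> \<delta> \<otimes>\<^bsub>B3\<^esub> h w \<in> M \<longleftrightarrow> inv\<^bsub>B3\<^esub> \<delta> \<otimes>\<^bsub>B3\<^esub> w \<in> M" if w: "w \<in> carrier B3" for w
    proof -
      have "inv\<^bsub>B3\<^esub> w \<otimes>\<^bsub>B3\<^esub> h w \<in> M" using coset[OF w, rule_format, of "\<one>\<^bsub>B3\<^esub>"] w by (simp add: h_def)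
      then show ?thesis
        using mult_mem_iff'[of "inv\<^bsub>B3\<^esub> w \<otimes>\<^bsub>B3\<^esub> h w" "inv\<^bsub>B3\<^esub> \<delta> \<otimes>\<^bsub>B3\<^esub> w"] w by (simp add: B3.m_assoc)
    qed
    have hd: "h (\<delta> \<otimes>\<^bsub>B3\<^esub> w) = \<delta> \<otimes>\<^bsub>B3\<^esub> h w" and hD: "h (\<Delta> \<otimes>\<^bsub>B3\<^esub> w) = t (h w)"
      and hiz: "h (inv\<^bsub>B3\<^esub> \<zeta> \<otimes>\<^bsub>B3\<^esub> w) = inv\<^bsub>B3\<^esub> \<zeta> \<otimes>\<^bsub>B3\<^esub> h w" if "w \<in> carrier B3" for w
      using that by (simp_all add: h_def mu dd D iZ)
    have RD: "R (\<Delta> \<otimes>\<^bsub>B3\<^esub> w)" if w: "w \<in> carrier B3" and Rw: "R w" for w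
    proof -
      have Pw: "inv\<^bsub>B3\<^esub> (h w) \<otimes>\<^bsub>B3\<^esub> w \<in> P" using Rw by (simp add: R_def)
      consider "w \<in> M" | "w \<notin> M" "inv\<^bsub>B3\<^esub> \<delta> \<otimes>\<^bsub>B3\<^esub> w \<in> M" | "w \<notin> M" "inv\<^bsub>B3\<^esub> \<delta> \<otimes>\<^bsub>B3\<^esub> w \<notin> M"
        by blast
      then show ?thesis
      proof cases
        case 1
        obtain k :: int where k: "h w = \<zeta> [^]\<^bsub>B3\<^esub> k" using hz 1 by blast
        have "w = h w \<otimes>\<^bsub>B3\<^esub> (inv\<^bsub>B3\<^esub> (h w) \<otimes>\<^bsub>B3\<^esub> w)" using w by simp
        then have wP: "w \<in> P" using Pcl Pw Pz k by metis
        have "h (\<Delta> \<otimes>\<^bsub>B3\<^esub> w) = \<delta> \<otimes>\<^bsub>B3\<^esub> h w"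
          using 1 hM w by (simp add: hD twisted_half_twist_def)
        moreover have "\<Delta> \<otimes>\<^bsub>B3\<^esub> w = \<delta> \<otimes>\<^bsub>B3\<^esub> (\<sigma>\<^sub>1 \<otimes>\<^bsub>B3\<^esub> w)"
          using w by (simp add: \<Delta>_eq B3.m_assoc)
        ultimately have "inv\<^bsub>B3\<^esub> (h (\<Delta> \<otimes>\<^bsub>B3\<^esub> w)) \<otimes>\<^bsub>B3\<^esub> (\<Delta> \<otimes>\<^bsub>B3\<^esub> w) = inv\<^bsub>B3\<^esub> (h w) \<otimes>\<^bsub>B3\<^esub> (\<sigma>\<^sub>1 \<otimes>\<^bsub>B3\<^esub> w)"
          using w by (simp add: B3.inv_mult_group B3.m_assoc)
        then show ?thesis unfolding R_def using Pcl P1 wP Pz k by metis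
      next
        case 2
        define v where "v = inv\<^bsub>B3\<^esub> \<delta> \<otimes>\<^bsub>B3\<^esub> w"
        have v: "v \<in> M" "w = \<delta> \<otimes>\<^bsub>B3\<^esub> v" using 2 w by (auto simp: v_def)
        obtain k :: int where k: "h v = \<zeta> [^]\<^bsub>B3\<^esub> k" using hz v by blast
        have hw: "h w = \<delta> \<otimes>\<^bsub>B3\<^esub> h v" using v hd by simp
        have "inv\<^bsub>B3\<^esub> (h v) \<otimes>\<^bsub>B3\<^esub> v \<in> P"
          using Pw v(1) unfolding hw v(2) by (simp add: hd B3.inv_mult_group B3.m_assoc)
        moreover have "v = h v \<otimes>\<^bsub>B3\<^esub> (inv\<^bsub>B3\<^esub> (h v) \<otimes>\<^bsub>B3\<^esub> v)" using v by simp
        ultimately have vP: "v \<in> P" using Pcl Pz k by metis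
        have "h w \<notin> M" "inv\<^bsub>B3\<^esub> \<delta> \<otimes>\<^bsub>B3\<^esub> h w \<in> M" using 2 w hin hdin by auto
        then have "h (\<Delta> \<otimes>\<^bsub>B3\<^esub> w) = \<zeta> \<otimes>\<^bsub>B3\<^esub> h v"
          using w v(1) unfolding hD[OF w] by (simp add: twisted_half_twist_def hw)
        moreover have "\<Delta> \<otimes>\<^bsub>B3\<^esub> w = \<zeta> \<otimes>\<^bsub>B3\<^esub> inv\<^bsub>B3\<^esub> \<sigma>\<^sub>1 \<otimes>\<^bsub>B3\<^esub> v"
          using v by (simp flip: \<Delta>_mult_\<delta> B3.m_assoc)
        ultimately have "inv\<^bsub>B3\<^esub> (h (\<Delta> \<otimes>\<^bsub>B3\<^esub> w)) \<otimes>\<^bsub>B3\<^esub> (\<Delta> \<otimes>\<^bsub>B3\<^esub> w)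
            = inv\<^bsub>B3\<^esub> (h v) \<otimes>\<^bsub>B3\<^esub> (inv\<^bsub>B3\<^esub> \<sigma>\<^sub>1 \<otimes>\<^bsub>B3\<^esub> v)"
          using v by (simp add: B3.inv_mult_group B3.m_assoc)
        then show ?thesis unfolding R_def using Pcl P1 vP Pz k by metis
      next
        case 3
        then have "t (h w) = \<Delta> \<otimes>\<^bsub>B3\<^esub> h w"
          using hin[OF w] hdin[OF w] by (simp add: twisted_half_twist_def)
        then show ?thesis using Pw w by (simp add: R_def hD B3.inv_mult_group B3.m_assoc)
      qed
    qed
    have Rd: "R (\<delta> \<otimes>\<^bsub>B3\<^esub> w)" "R (inv\<^bsub>B3\<^esub> \<zeta> \<otimes>\<^bsub>B3\<^esub> w)" if "w \<in> carrier B3" "R w" for w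
      using that by (simp_all add: R_def hd hiz B3.inv_mult_group B3.m_assoc)
    have "\<forall>w\<in>carrier B3. R w \<longrightarrow> R (g \<otimes>\<^bsub>B3\<^esub> w)" if "g \<in> carrier B3" for g
      using that by (rule B3_induct) (auto simp: RD Rd B3.m_assoc)
    moreover have "R \<one>\<^bsub>B3\<^esub>" using P by (simp add: R_def h_def un subgroup.one_closed)
    ultimately have "R m" using \<open>m \<in> M\<close> by (metis B3.one_closed B3.r_one mem_carrier_B3)
    moreover obtain k :: int where k: "h m = \<zeta> [^]\<^bsub>B3\<^esub> k" using hz \<open>m \<in> M\<close> by blast
    moreover have "m = h m \<otimes>\<^bsub>B3\<^esub> (inv\<^bsub>B3\<^esub> (h m) \<otimes>\<^bsub>B3\<^esub> m)" using \<open>m \<in> M\<close> by simp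
    ultimately have "m \<in> P" unfolding R_def using Pcl Pz by metis
    then show ?thesis by (simp add: P_def)
  qed
  ultimately show thesis using that by blast
qed

end

text \<open>If \<open>\<delta>\<close> is not in \<open>M = H\<langle>\<zeta>\<rangle>\<close>, the homomorphism of \<open>twisted_action_hom\<close> kills \<open>\<sigma>\<^sub>1\<close>, hence \<open>H\<close>, hence takes only
  powers of \<open>\<zeta>\<close> as values on \<open>M\<close>.\<close>

lemma subgroup_B3_dichotomy:
  assumes H: "subgroup H B3" and s: "\<sigma>\<^sub>1 \<in> H"
    and weight: "\<And>h x. \<lbrakk>h \<in> hom (B3\<lparr>carrier := H\<rparr>) B3; h \<sigma>\<^sub>1 = \<one>\<^bsub>B3\<^esub>; x \<in> H\<rbrakk> \<Longrightarrow> h x = \<one>\<^bsub>B3\<^esub>"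
  shows "H = carrier B3 \<or> (\<forall>x\<in>H. \<sigma>\<^sub>1 \<otimes>\<^bsub>B3\<^esub> x = x \<otimes>\<^bsub>B3\<^esub> \<sigma>\<^sub>1)"
proof (cases "\<delta> \<in> modulo_centre H")
  case True
  then show ?thesis using subgroup_eq_B3I[OF H s] by blast
next
  case False
  let ?M = "modulo_centre H"
  have HM: "H \<subseteq> ?M" by (rule subset_modulo_centre[OF H])
  interpret twisting_subgroup ?M
    by (rule twisting_subgroup.intro)
      (use False H s HM in \<open>simp_all add: subgroup_modulo_centre \<zeta>_in_modulo_centre subset_iff\<close>)
  obtain h where h: "h \<in> hom (B3\<lparr>carrier := ?M\<rparr>) B3" "h \<sigma>\<^sub>1 = \<one>\<^bsub>B3\<^esub>" "h \<zeta> = \<zeta>"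
    and comm: "(\<forall>m\<in>?M. \<exists>k::int. h m = \<zeta> [^]\<^bsub>B3\<^esub> k) \<longrightarrow>
      (\<forall>m\<in>?M. \<sigma>\<^sub>1 \<otimes>\<^bsub>B3\<^esub> m = m \<otimes>\<^bsub>B3\<^esub> \<sigma>\<^sub>1)"
    by (rule twisted_action_hom)
  have gM: "group (B3\<lparr>carrier := ?M\<rparr>)" by (rule subgroup.subgroup_is_group[OF M group_B3])
  have zM: "\<zeta> [^]\<^bsub>B3\<^esub> k \<in> ?M" for k :: int
    by (rule B3.subgroup_int_pow_closed[OF M z])
  interpret hh: group_hom "B3\<lparr>carrier := ?M\<rparr>" B3 h
    by (intro group_hom.intro gM group_B3 group_hom_axioms.intro h(1))
  have hz: "h (\<zeta> [^]\<^bsub>B3\<^esub> k) = \<zeta> [^]\<^bsub>B3\<^esub> k" for k :: int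
  proof -
    have "h (\<zeta> [^]\<^bsub>B3\<lparr>carrier := ?M\<rparr>\<^esub> k) = h \<zeta> [^]\<^bsub>B3\<^esub> k"
      by (rule hh.hom_int_pow) (use z in simp)
    then show ?thesis using B3.int_pow_consistent[OF M z] h(3) by simp
  qed
  have "h \<in> hom (B3\<lparr>carrier := H\<rparr>) B3"
    using h(1) HM by (auto simp: hom_def)
  then have hH: "h x = \<one>\<^bsub>B3\<^esub>" if "x \<in> H" for x using weight h(2) that by blast
  have "\<exists>k::int. h m = \<zeta> [^]\<^bsub>B3\<^esub> k" if m: "m \<in> ?M" for m
  proof -
    obtain k :: int where k: "m \<otimes>\<^bsub>B3\<^esub> \<zeta> [^]\<^bsub>B3\<^esub> k \<in> H" using m unfolding modulo_centre_def by blast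
    have hm: "h m \<in> carrier B3" using hh.hom_closed[of m] m by simp
    have "h m \<otimes>\<^bsub>B3\<^esub> \<zeta> [^]\<^bsub>B3\<^esub> k = h (m \<otimes>\<^bsub>B3\<^esub> \<zeta> [^]\<^bsub>B3\<^esub> k)"
      using hom_mult[OF h(1), of m "\<zeta> [^]\<^bsub>B3\<^esub> k"] m zM[of k] unfolding hz by simp
    then have "inv\<^bsub>B3\<^esub> (\<zeta> [^]\<^bsub>B3\<^esub> k) = h m"
      unfolding hH[OF k] by (rule B3.inv_equality) (simp_all add: hm)
    then have "h m = \<zeta> [^]\<^bsub>B3\<^esub> (- k)"
      by (simp only: B3.int_pow_neg torus_gens_closed)
    then show ?thesis by blast
  qed
  then have "\<sigma>\<^sub>1 \<otimes>\<^bsub>B3\<^esub> x = x \<otimes>\<^bsub>B3\<^esub> \<sigma>\<^sub>1" if "x \<in> H" for x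
    using comm subsetD[OF HM that] by blast
  then show ?thesis by simp
qed

section \<open>Colorings as epimorphisms\<close>

lemma (in group) conjugation_hom:
  assumes "k \<in> carrier G"
  shows "(\<lambda>g. inv k \<otimes> g \<otimes> k) \<in> hom G G"
proof (rule homI)
  fix x y assume "x \<in> carrier G" "y \<in> carrier G"
  moreover have "k \<otimes> (inv k \<otimes> z) = z" if "z \<in> carrier G" for z
    using assms that by (simp flip: m_assoc)
  ultimately show "inv k \<otimes> (x \<otimes> y) \<otimes> k = (inv k \<otimes> x \<otimes> k) \<otimes> (inv k \<otimes> y \<otimes> k)"
    using assms by (simp add: m_assoc)
qed (use assms in simp)

text \<open>If the dichotomy for the image gave the centralizer of \<open>\<sigma>\<^sub>1\<close>, conjugation in the image would fix the
  value of a meridian, and two meridians could not have different values.\<close>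

theorem theorem8p4p1:
  fixes K :: "(real^4) set"
    and N :: "complex \<times> complex \<Rightarrow> real^4"
    and x\<^sub>0 :: "real^4"
    and \<phi> :: "(real \<Rightarrow> real^4) set \<Rightarrow> braid_word set"
  assumes "knot K"
    and "tubular_neighbourhood K N"
    and "x\<^sub>0 \<in> S3 - K"
    and "simple_B3_coloring K N x\<^sub>0 \<phi>"
    and "nontrivial_coloring K N x\<^sub>0 \<phi>"
  shows "\<exists>\<psi>. \<psi> \<in> epi (knot_group K x\<^sub>0) B3"
proof -
  let ?P = "knot_group K x\<^sub>0"
  note tube = assms(2) and x\<^sub>0 = assms(3)
  interpret P: group ?P
    unfolding knot_group_def by (rule group_fundamental_group[OF x\<^sub>0])
  have \<phi>: "\<phi> \<in> hom ?P B3"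
    and simple: "\<And>m. m \<in> meridians K N x\<^sub>0 \<Longrightarrow> \<phi> m \<in> conjugates B3 \<sigma>\<^sub>1 \<union> conjugates B3 (inv\<^bsub>B3\<^esub> \<sigma>\<^sub>1)"
    using assms(4) by (simp_all add: simple_B3_coloring_def)
  obtain m\<^sub>0 m\<^sub>1 where m\<^sub>0: "m\<^sub>0 \<in> meridians K N x\<^sub>0" and m\<^sub>1: "m\<^sub>1 \<in> meridians K N x\<^sub>0"
    and ne: "\<phi> m\<^sub>0 \<noteq> \<phi> m\<^sub>1"
    using assms(5) unfolding nontrivial_coloring_def by blast
  have mcar: "m \<in> carrier ?P" if "m \<in> meridians K N x\<^sub>0" for m
    using meridians_subset_knot_group[OF tube] that by blast
  obtain k s where k: "k \<in> carrier B3" and s: "s = \<sigma>\<^sub>1 \<or> s = inv\<^bsub>B3\<^esub> \<sigma>\<^sub>1"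
    and \<phi>m\<^sub>0: "\<phi> m\<^sub>0 = k \<otimes>\<^bsub>B3\<^esub> s \<otimes>\<^bsub>B3\<^esub> inv\<^bsub>B3\<^esub> k"
    using simple[OF m\<^sub>0] unfolding conjugates_def by blast
  have scl: "s \<in> carrier B3" using s by auto
  define \<psi> where "\<psi> g = inv\<^bsub>B3\<^esub> k \<otimes>\<^bsub>B3\<^esub> \<phi> g \<otimes>\<^bsub>B3\<^esub> k" for g
  have \<psi>: "\<psi> \<in> hom ?P B3"
    using hom_compose[OF \<phi> B3.conjugation_hom[OF k]] by (simp add: comp_def \<psi>_def[abs_def])
  interpret \<psi>: group_hom ?P B3 \<psi>
    by (intro group_hom.intro group_hom_axioms.intro P.group_axioms group_B3 \<psi>)
  have \<psi>m\<^sub>0: "\<psi> m\<^sub>0 = s"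
    using k scl by (simp add: \<psi>_def \<phi>m\<^sub>0 B3.m_assoc)
  have conj: "\<exists>x\<in>carrier ?P. m = x \<otimes>\<^bsub>?P\<^esub> m\<^sub>0 \<otimes>\<^bsub>?P\<^esub> inv\<^bsub>?P\<^esub> x" if "m \<in> meridians K N x\<^sub>0" for m
    using meridians_conjugate[OF tube x\<^sub>0 that m\<^sub>0] unfolding conjugates_def by blast
  define H where "H = \<psi> ` carrier ?P"
  have H: "subgroup H B3" unfolding H_def by (rule \<psi>.img_is_subgroup)
  have sH: "s \<in> H" unfolding H_def using \<psi>m\<^sub>0 mcar[OF m\<^sub>0] by blast
  have s1H: "\<sigma>\<^sub>1 \<in> H" using s sH subgroup.m_inv_closed[OF H sH] by auto
  \<comment> \<open>The meridians have conjugates of s as images, so a homomorphism on H that kills s is trivial.\<close>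
  have weight: "h y = \<one>\<^bsub>B3\<^esub>" if h: "h \<in> hom (B3\<lparr>carrier := H\<rparr>) B3" "h \<sigma>\<^sub>1 = \<one>\<^bsub>B3\<^esub>" and y: "y \<in> H" for h y
  proof -
    have \<psi>H: "\<psi> \<in> hom ?P (B3\<lparr>carrier := H\<rparr>)"
      using \<psi> by (auto simp: hom_def H_def)
    have grH: "group (B3\<lparr>carrier := H\<rparr>)" by (rule subgroup.subgroup_is_group[OF H group_B3])
    interpret h: group_hom "B3\<lparr>carrier := H\<rparr>" B3 h
      by (intro group_hom.intro group_hom_axioms.intro grH group_B3 h(1))
    have h\<psi>: "h \<circ> \<psi> \<in> hom ?P B3" by (rule hom_compose[OF \<psi>H h(1)])
    interpret h\<psi>: group_hom ?P B3 "h \<circ> \<psi>"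
      by (intro group_hom.intro group_hom_axioms.intro P.group_axioms group_B3 h\<psi>)
    have hs: "h s = \<one>\<^bsub>B3\<^esub>"
      using s h(2) h.hom_inv[of \<sigma>\<^sub>1] B3.m_inv_consistent[OF H s1H] s1H by auto
    have "(h \<circ> \<psi>) m = \<one>\<^bsub>B3\<^esub>" if m: "m \<in> meridians K N x\<^sub>0" for m
    proof -
      obtain x where x: "x \<in> carrier ?P" and mx: "m = x \<otimes>\<^bsub>?P\<^esub> m\<^sub>0 \<otimes>\<^bsub>?P\<^esub> inv\<^bsub>?P\<^esub> x"
        using conj[OF m] by blast
      have "(h \<circ> \<psi>) m\<^sub>0 = \<one>\<^bsub>B3\<^esub>" by (simp add: \<psi>m\<^sub>0 hs)
      then have "(h \<circ> \<psi>) m = (h \<circ> \<psi>) x \<otimes>\<^bsub>B3\<^esub> \<one>\<^bsub>B3\<^esub> \<otimes>\<^bsub>B3\<^esub> inv\<^bsub>B3\<^esub> ((h \<circ> \<psi>) x)"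
        unfolding mx using x mcar[OF m\<^sub>0]
        by (simp only: h\<psi>.hom_mult h\<psi>.hom_inv P.m_closed P.inv_closed)
      also have "\<dots> = \<one>\<^bsub>B3\<^esub>" using h\<psi>.hom_closed[OF x] by (simp only: B3.r_one B3.r_inv)
      finally show ?thesis .
    qed
    then have "(h \<circ> \<psi>) g = \<one>\<^bsub>B3\<^esub>" if "g \<in> carrier ?P" for g
      using hom_trivial_if_kills_meridians[OF tube x\<^sub>0 group_B3 h\<psi> _ that] by blast
    then show ?thesis using y by (auto simp: H_def)
  qed
  have "H = carrier B3 \<or> (\<forall>y\<in>H. \<sigma>\<^sub>1 \<otimes>\<^bsub>B3\<^esub> y = y \<otimes>\<^bsub>B3\<^esub> \<sigma>\<^sub>1)"
    by (rule subgroup_B3_dichotomy[OF H s1H]) (rule weight)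
  then show ?thesis
  proof
    assume "H = carrier B3"
    then have "\<psi> \<in> epi ?P B3" using \<psi> by (simp add: epi_def H_def)
    then show ?thesis by blast
  next
    assume comm: "\<forall>y\<in>H. \<sigma>\<^sub>1 \<otimes>\<^bsub>B3\<^esub> y = y \<otimes>\<^bsub>B3\<^esub> \<sigma>\<^sub>1"
    have s_comm: "y \<otimes>\<^bsub>B3\<^esub> s = s \<otimes>\<^bsub>B3\<^esub> y" if "y \<in> H" for y
    proof -
      have ycl: "y \<in> carrier B3" using H that by (rule subgroup.mem_carrier)
      have c: "\<sigma>\<^sub>1 \<otimes>\<^bsub>B3\<^esub> y = y \<otimes>\<^bsub>B3\<^esub> \<sigma>\<^sub>1" using comm that by blast
      have "inv\<^bsub>B3\<^esub> \<sigma>\<^sub>1 \<otimes>\<^bsub>B3\<^esub> (\<sigma>\<^sub>1 \<otimes>\<^bsub>B3\<^esub> y) \<otimes>\<^bsub>B3\<^esub> inv\<^bsub>B3\<^esub> \<sigma>\<^sub>1 = y \<otimes>\<^bsub>B3\<^esub> inv\<^bsub>B3\<^esub> \<sigma>\<^sub>1"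
        using ycl by (simp add: B3.m_assoc)
      then have "y \<otimes>\<^bsub>B3\<^esub> inv\<^bsub>B3\<^esub> \<sigma>\<^sub>1 = inv\<^bsub>B3\<^esub> \<sigma>\<^sub>1 \<otimes>\<^bsub>B3\<^esub> y"
        unfolding c using ycl by (simp add: B3.m_assoc)
      then show ?thesis using s c by auto
    qed
    obtain x where x: "x \<in> carrier ?P" and mx: "m\<^sub>1 = x \<otimes>\<^bsub>?P\<^esub> m\<^sub>0 \<otimes>\<^bsub>?P\<^esub> inv\<^bsub>?P\<^esub> x"
      using conj[OF m\<^sub>1] by blast
    have "\<psi> m\<^sub>1 = \<psi> x \<otimes>\<^bsub>B3\<^esub> s \<otimes>\<^bsub>B3\<^esub> inv\<^bsub>B3\<^esub> (\<psi> x)"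
      unfolding mx using x mcar[OF m\<^sub>0] by (simp add: \<psi>m\<^sub>0)
    also have "\<psi> x \<otimes>\<^bsub>B3\<^esub> s = s \<otimes>\<^bsub>B3\<^esub> \<psi> x" by (rule s_comm) (use x in \<open>simp add: H_def\<close>)
    also have "s \<otimes>\<^bsub>B3\<^esub> \<psi> x \<otimes>\<^bsub>B3\<^esub> inv\<^bsub>B3\<^esub> (\<psi> x) = s"
      using x scl by (simp add: B3.m_assoc)
    finally have "\<psi> m\<^sub>1 = \<psi> m\<^sub>0" using \<psi>m\<^sub>0 by simp
    then have "\<phi> m\<^sub>1 = \<phi> m\<^sub>0"
      unfolding \<psi>_def using k hom_in_carrier[OF \<phi>] mcar[OF m\<^sub>0] mcar[OF m\<^sub>1] by simp
    then show ?thesis using ne by simp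
  qed
qed

end
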